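(* Let $p\in(0,1]$, $q\in[p,1]$, and let $\mathcal B_q$ be a $q$-quasi-Banach space. Let $s_1,s_2\in\mathbb Z_+$ and, for $i=1,2$, $\sigma_i\in(\max\{n_i/p,\,n_i+s_i\},\,n_i+s_i+1)$. Let $T$ be a $\mathcal B_q$-sublinear operator from $\mathcal D_{s_1,s_2}(\mathbb R^{n_1}\times\mathbb R^{n_2})$ to $\mathcal B_q$. Suppose there exists $C>0$ such that for all $f\in\mathcal D_{s_1,s_2}(\mathbb R^{n_1}\times\mathbb R^{n_2})$, $$\|Tf\|_{\mathcal B_q}\le C\Big[\sup_{x_2\in\mathbb R^{n_2}}\operatorname{diam}(\operatorname{supp}f(\cdot,x_2))\Big]^{n_1/p}\Big[\sup_{x_1\in\mathbb R^{n_1}}\operatorname{diam}(\operatorname{supp}f(x_1,\cdot))\Big]^{n_2/p}\|f\|_{L^\infty}.$$ Then there exists $C'>0$ such that $\|Tf\|_{\mathcal B_q}\le C'\|f\|_{\mathcal D_{s_1,s_2;\sigma_1,\sigma_2}}$ for all $f\in\mathcal D_{s_1,s_2}(\mathbb R^{n_1}\times\mathbb R^{n_2})$; i.e. $T$ extends to a bounded $\mathcal B_q$-sublinear operator from $\mathcal D_{s_1,s_2;\sigma_1,\sigma_2}(\mathbb R^{n_1}\times\mathbb R^{n_2})$ to $\mathcal B_q$.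
   Context: $\mathcal D_{s_1,s_2}(\mathbb R^{n_1}\times\mathbb R^{n_2})$ is the set of smooth compactly supported $f$ on $\mathbb R^{n_1}\times\mathbb R^{n_2}$ with $\int_{\mathbb R^{n_1}}f(x_1,x_2)x_1^{\alpha_1}dx_1=0$ for all $x_2$, $|\alpha_1|\le s_1$, and $\int_{\mathbb R^{n_2}}f(x_1,x_2)x_2^{\alpha_2}dx_2=0$ for all $x_1$, $|\alpha_2|\le s_2$. $\mathcal D_{s_1,s_2;\sigma_1,\sigma_2}$ denotes this space with the norm $\|f\|_{\mathcal D_{s_1,s_2;\sigma_1,\sigma_2}}=\sup_{x_1,x_2}(1+|x_1|)^{\sigma_1}(1+|x_2|)^{\sigma_2}|f(x_1,x_2)|$. Here $\sup_{x_2}\operatorname{diam}(\operatorname{supp}f(\cdot,x_2))=\sup\{|x_1-y_1|: x_2\in\mathbb R^{n_2},\ f(x_1,x_2)\ne0,\ f(y_1,x_2)\ne0\}$, and $\sup_{x_1}\operatorname{diam}(\operatorname{supp}f(x_1,\cdot))$ is defined symmetrically. A $q$-quasi-Banach space ($q\in(0,1]$) is a quasi-Banach space $\mathcal B_q$ whose quasi-norm satisfies $\|f+g\|^q_{\mathcal B_q}\le\|f\|^q_{\mathcal B_q}+\|g\|^q_{\mathcal B_q}$. An operator $T$ from a linear space $\mathcal Y$ into $\mathcal B_q$ is $\mathcal B_q$-sublinear if for all $f,g\in\mathcal Y$ and $\lambda,\nu\in\mathbb C$: $\|T(\lambda f+\nu g)\|_{\mathcal B_q}\le(|\lambda|^q\|Tf\|^q_{\mathcal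 B_q}+|\nu|^q\|Tg\|^q_{\mathcal B_q})^{1/q}$ and $\|Tf-Tg\|_{\mathcal B_q}\le\|T(f-g)\|_{\mathcal B_q}$. *)

theory Defs
  imports "HOL-Analysis.Analysis"
begin

fun Ck :: "nat \<Rightarrow> ('c::euclidean_space \<Rightarrow> complex) \<Rightarrow> bool" where
  "Ck 0 g = continuous_on UNIV g"
| "Ck (Suc k) g = (\<exists>g'. (\<forall>x. (g has_derivative g' x) (at x)) \<and> (\<forall>v. Ck k (\<lambda>x. g' x v)))"

definition smooth :: "('c::euclidean_space \<Rightarrow> complex) \<Rightarrow> bool" where
  "smooth g \<longleftrightarrow> (\<forall>k. Ck k g)"

definition monom_ml :: "('c::euclidean_space \<Rightarrow> nat) \<Rightarrow> 'c \<Rightarrow> real" where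
  "monom_ml \<alpha> x = (\<Prod>i\<in>Basis. (x \<bullet> i) ^ (\<alpha> i))"

definition mi_order :: "('c::euclidean_space \<Rightarrow> nat) \<Rightarrow> nat" where
  "mi_order \<alpha> = (\<Sum>i\<in>Basis. \<alpha> i)"

definition Dspace :: "nat \<Rightarrow> nat \<Rightarrow> ('a::euclidean_space \<Rightarrow> 'b::euclidean_space \<Rightarrow> complex) set" where
  "Dspace s1 s2 = {f.
     smooth (\<lambda>z. f (fst z) (snd z)) \<and>
     compact (closure {z. f (fst z) (snd z) \<noteq> 0}) \<and>
     (\<forall>x2 \<alpha>. mi_order \<alpha> \<le> s1 \<longrightarrow>
        (LINT x1|lborel. f x1 x2 * complex_of_real (monom_ml \<alpha> x1)) = 0) \<and>
     (\<forall>x1 \<alpha>. mi_order \<alpha> \<le> s2 \<longrightarrow>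
        (LINT x2|lborel. f x1 x2 * complex_of_real (monom_ml \<alpha> x2)) = 0)}"

definition Dnorm :: "real \<Rightarrow> real \<Rightarrow> ('a::euclidean_space \<Rightarrow> 'b::euclidean_space \<Rightarrow> complex) \<Rightarrow> real" where
  "Dnorm \<sigma>1 \<sigma>2 f = (SUP z. (1 + norm (fst z)) powr \<sigma>1 * (1 + norm (snd z)) powr \<sigma>2 * cmod (f (fst z) (snd z)))"

definition sup_norm :: "('a \<Rightarrow> 'b \<Rightarrow> complex) \<Rightarrow> real" where
  "sup_norm f = (SUP z. cmod (f (fst z) (snd z)))"

text \<open>sup_{x2} diam(supp f(.,x2)) and sup_{x1} diam(supp f(x1,.)); 0 for f = 0.\<close>
definition diam1 :: "('a::metric_space \<Rightarrow> 'b \<Rightarrow> complex) \<Rightarrow> real" where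
  "diam1 f = Sup ({dist x1 y1 | x1 y1 x2. f x1 x2 \<noteq> 0 \<and> f y1 x2 \<noteq> 0} \<union> {0})"

definition diam2 :: "('a \<Rightarrow> 'b::metric_space \<Rightarrow> complex) \<Rightarrow> real" where
  "diam2 f = Sup ({dist x2 y2 | x2 y2 x1. f x1 x2 \<noteq> 0 \<and> f x1 y2 \<noteq> 0} \<union> {0})"

definition q_quasi_banach :: "real \<Rightarrow> (complex \<Rightarrow> 'v::ab_group_add \<Rightarrow> 'v) \<Rightarrow> ('v \<Rightarrow> real) \<Rightarrow> bool" where
  "q_quasi_banach q sc N \<longleftrightarrow>
     vector_space sc \<and> 0 < q \<and> q \<le> 1 \<and>
     (\<forall>x. 0 \<le> N x) \<and> (\<forall>x. N x = 0 \<longleftrightarrow> x = 0) \<and>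
     (\<forall>c x. N (sc c x) = cmod c * N x) \<and>
     (\<forall>x y. N (x + y) powr q \<le> N x powr q + N y powr q) \<and>
     (\<forall>X. (\<forall>e>0. \<exists>M. \<forall>m\<ge>M. \<forall>n\<ge>M. N (X m - X n) < e) \<longrightarrow>
          (\<exists>L. (\<lambda>n. N (X n - L)) \<longlonglongrightarrow> 0))"

definition Bq_sublinear :: "real \<Rightarrow> ('v::ab_group_add \<Rightarrow> real) \<Rightarrow> (('a \<Rightarrow> 'b \<Rightarrow> complex) \<Rightarrow> 'v) \<Rightarrow>
    ('a \<Rightarrow> 'b \<Rightarrow> complex) set \<Rightarrow> bool" where
  "Bq_sublinear q N T Y \<longleftrightarrow>
     (\<forall>f\<in>Y. \<forall>g\<in>Y. \<forall>l v::complex.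
        N (T (\<lambda>x y. l * f x y + v * g x y))
          \<le> (cmod l powr q * N (T f) powr q + cmod v powr q * N (T g) powr q) powr (1 / q)
      \<and> N (T f - T g) \<le> N (T (\<lambda>x y. f x y - g x y)))"

end

theory Submission
  imports Defs
begin

text \<open>
  In one variable, let \<open>\<theta>\<^sub>i\<close> be a smooth cutoff to the ball of radius \<open>2\<^sup>i\<close> and let
  \<open>\<phi>\<^sub>i\<^sub>,\<^sub>\<alpha>\<close> be bumps at scale \<open>2\<^sup>i\<close> that are dual to the monomials of order at most \<open>s\<close>.  Then
  \<open>P\<^sub>i h = \<theta>\<^sub>i h - (\<Sum>\<alpha>. moment\<^sub>\<alpha> (\<theta>\<^sub>i h) \<phi>\<^sub>i\<^sub>,\<^sub>\<alpha>)\<close> has vanishing moments and equals \<open>h\<close> for large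
  \<open>i\<close>, so that \<open>h\<close> is the telescoping sum of the blocks \<open>P\<^sub>i h - P\<^sub>i\<^sub>-\<^sub>1 h\<close>.  As the moments of \<open>h\<close>
  vanish, those of \<open>\<theta>\<^sub>i h\<close> are minus tail moments, and decay of \<open>h\<close> of order \<open>\<sigma> > n + s\<close> bounds the
  \<open>i\<close>-th block by a multiple of \<open>2\<close> to the power \<open>- i \<sigma>\<close>.  Doing this in both variables
  decomposes \<open>f\<close> into pieces to which the hypothesis on \<open>T\<close> applies, and since \<open>\<sigma> > n / p\<close> the
  \<open>q\<close>-th powers of the resulting bounds form a convergent double geometric series.
\<close>

subsection \<open>Calculus of Ck functions\<close>

lemma Ck_Suc_imp_Ck: "Ck (Suc k) g \<Longrightarrow> Ck k g"
proof (induction k arbitrary: g)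
  case 0
  then show ?case
    by (auto intro!: continuous_at_imp_continuous_on dest: has_derivative_continuous)
next
  case (Suc k)
  then show ?case by (metis Ck.simps(2))
qed

lemma Ck_continuous: "Ck k g \<Longrightarrow> continuous_on UNIV g"
  by (induction k) (auto dest: Ck_Suc_imp_Ck simp del: Ck.simps(2))

lemma Ck_const [simp]: "Ck k (\<lambda>x. c)"
proof (induction k arbitrary: c)
  case (Suc k)
  show ?case by (auto intro!: exI[of _ "\<lambda>x v. 0"] Suc)
qed simp

lemma Ck_add: "Ck k f \<Longrightarrow> Ck k g \<Longrightarrow> Ck k (\<lambda>x. f x + g x)"
proof (induction k arbitrary: f g)
  case (Suc k)
  obtain f' g' where f': "\<And>x. (f has_derivative f' x) (at x)" "\<And>v. Ck k (\<lambda>x. f' x v)"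
    and g': "\<And>x. (g has_derivative g' x) (at x)" "\<And>v. Ck k (\<lambda>x. g' x v)"
    using Suc.prems by auto
  show ?case
    by (auto intro!: exI[of _ "\<lambda>x v. f' x v + g' x v"] Suc.IH f' g' derivative_intros)
qed (simp add: continuous_on_add)

lemma Ck_mult: "Ck k f \<Longrightarrow> Ck k g \<Longrightarrow> Ck k (\<lambda>x. f x * g x)"
proof (induction k arbitrary: f g)
  case (Suc k)
  obtain f' g' where f': "\<And>x. (f has_derivative f' x) (at x)" "\<And>v. Ck k (\<lambda>x. f' x v)"
    and g': "\<And>x. (g has_derivative g' x) (at x)" "\<And>v. Ck k (\<lambda>x. g' x v)"
    using Suc.prems by auto
  have "Ck k f" "Ck k g" using Suc.prems Ck_Suc_imp_Ck by blast+
  then show ?case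
    by (auto intro!: exI[of _ "\<lambda>x v. f x * g' x v + f' x v * g x"] Suc.IH Ck_add f' g'
        derivative_intros)
qed (simp add: continuous_on_mult)

lemma Ck_diff: "Ck k f \<Longrightarrow> Ck k g \<Longrightarrow> Ck k (\<lambda>x. f x - g x)"
  using Ck_add[of k f "\<lambda>x. -1 * g x"] Ck_mult[of k "\<lambda>x. -1" g] by simp

lemma Ck_sum: "(\<And>i. i \<in> F \<Longrightarrow> Ck k (f i)) \<Longrightarrow> Ck k (\<lambda>x. \<Sum>i\<in>F. f i x)"
  by (induction F rule: infinite_finite_induct) (auto intro: Ck_add)

lemma Ck_bounded_linear: "bounded_linear f \<Longrightarrow> Ck k f"
proof (cases k)
  case (Suc m)
  assume "bounded_linear f"
  then show ?thesis
    unfolding Suc by (auto intro!: exI[of _ "\<lambda>_. f"] bounded_linear_imp_has_derivative)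
qed (simp add: linear_continuous_on)

text \<open>Slices, scalings, translations and the exchange of variables are all affine. For such an
  inner map the direction \<open>L v\<close> does not depend on the point, so the induction
  hypothesis applies directly to the partial derivative of \<open>g\<close> in that
  direction.\<close>

lemma Ck_compose_affine:
  fixes L :: "'a::euclidean_space \<Rightarrow> 'b::euclidean_space"
  assumes "bounded_linear L"
  shows "Ck k g \<Longrightarrow> Ck k (\<lambda>x. g (c + L x))"
proof (induction k arbitrary: g)
  case 0
  have "continuous_on UNIV L" using assms by (simp add: linear_continuous_on)
  with 0 show ?case
    by (auto intro!: continuous_on_compose2[of UNIV g] continuous_intros)
next
  case (Suc k)
  obtain g' where g': "\<And>x. (g has_derivative g' x) (at x)" "\<And>v. Ck k (\<lambda>x. g' x v)"
    using Suc.prems by auto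
  have "((\<lambda>x. c + L x) has_derivative L) (at x)" for x
    using has_derivative_add[OF has_derivative_const[of c] bounded_linear_imp_has_derivative[OF assms]]
    by simp
  then have "((\<lambda>x. g (c + L x)) has_derivative (\<lambda>v. g' (c + L x) (L v))) (at x)" for x
    using has_derivative_compose g' by blast
  then show ?case
    by (auto intro!: exI[of _ "\<lambda>x v. g' (c + L x) (L v)"] Suc.IH g')
qed

lemmas Ck_compose_linear = Ck_compose_affine[where c = 0, simplified]

text \<open>The derivative is a product of \<open>inverse g\<close>, which is \<open>Ck k\<close> by
  the induction hypothesis, and a directional derivative of \<open>g\<close>.\<close>

lemma Ck_inverse: "Ck k g \<Longrightarrow> (\<And>x. g x \<noteq> 0) \<Longrightarrow> Ck k (\<lambda>x. inverse (g x))"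
proof (induction k arbitrary: g)
  case (Suc k)
  obtain g' where g': "\<And>x. (g has_derivative g' x) (at x)" "\<And>v. Ck k (\<lambda>x. g' x v)"
    using Suc.prems by auto
  have "Ck k (\<lambda>x. inverse (g x))"
    using Suc.prems Suc.IH Ck_Suc_imp_Ck by blast
  then have "Ck k (\<lambda>x. (-1) * (inverse (g x) * g' x v * inverse (g x)))" for v
    by (intro Ck_mult g' Ck_const)
  moreover have "((\<lambda>x. inverse (g x)) has_derivative
      (\<lambda>v. (-1) * (inverse (g x) * g' x v * inverse (g x)))) (at x)" for x
    using Deriv.has_derivative_inverse[OF Suc.prems(2) g'(1), of x] by simp
  ultimately show ?case
    unfolding Ck.simps(2) by (intro exI conjI allI) assumption+
qed (simp add: continuous_on_inverse)

section \<open>Smooth functions vanishing to infinite order at 0\<close>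

definition flat_exp :: "nat \<Rightarrow> real \<Rightarrow> real" where
  "flat_exp k t = (if t \<le> 0 then 0 else exp (- 1 / t) / t ^ k)"

lemma flat_exp_pos: "0 < t \<Longrightarrow> 0 < flat_exp k t"
  and flat_exp_nonneg: "0 \<le> flat_exp k t"
  and flat_exp_eq_0 [simp]: "t \<le> 0 \<Longrightarrow> flat_exp k t = 0"
  by (auto simp: flat_exp_def)

text \<open>From the right the substitution \<open>u = inverse t\<close> gives
  \<open>u ^ k / exp u\<close>, which tends to 0 as \<open>u\<close> grows; from the left the
  function is 0.\<close>

lemma flat_exp_tendsto_0: "(flat_exp k \<longlongrightarrow> 0) (at 0)"
proof -
  have "((\<lambda>t. flat_exp k t) \<longlongrightarrow> 0) (at_right 0)"
  proof (rule Lim_transform_eventually)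
    show "((\<lambda>t. inverse t ^ k / exp (inverse t)) \<longlongrightarrow> 0) (at_right (0::real))"
      by (rule filterlim_compose[OF tendsto_power_div_exp_0 filterlim_inverse_at_top_right])
    show "\<forall>\<^sub>F t in at_right 0. inverse t ^ k / exp (inverse t) = flat_exp k t"
      by (auto simp: eventually_at_filter flat_exp_def field_simps exp_minus)
  qed
  moreover have "((\<lambda>t. flat_exp k t) \<longlongrightarrow> 0) (at_left 0)"
    by (rule tendsto_eventually) (auto simp: eventually_at_filter)
  ultimately show ?thesis by (rule filterlim_split_at[rotated])
qed

text \<open>The factor \<open>1 / t ^ k\<close> is built into the family to close it under
  differentiation: a derivative is a linear combination of the members with indices
  \<open>k + 1\<close> and \<open>k + 2\<close>, also at the origin.\<close>

lemma flat_exp_has_derivative: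
  "(flat_exp k has_real_derivative flat_exp (k + 2) t - real k * flat_exp (k + 1) t) (at t)"
proof (cases t "0::real" rule: linorder_cases)
  case less
  have "((\<lambda>_. 0) has_real_derivative 0) (at t)" by simp
  then have "(flat_exp k has_real_derivative 0) (at t)"
    by (rule DERIV_cong_ev[THEN iffD1, rotated -1])
       (use less eventually_nhds_in_open[of "{..<0}" t] in \<open>auto elim!: eventually_mono\<close>)
  with less show ?thesis by simp
next
  case equal
  \<comment> \<open>The difference quotient of \<open>flat_exp k\<close> at 0 is
    \<open>flat_exp (k + 1)\<close>, so its limit is already known.\<close>
  have "((\<lambda>h. flat_exp (k + 1) h) \<longlongrightarrow> 0) (at 0)" by (rule flat_exp_tendsto_0)
  then have "((\<lambda>h. (flat_exp k h - flat_exp k 0) / h) \<longlongrightarrow> 0) (at 0)"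
    by (rule Lim_transform_eventually) (auto simp: flat_exp_def eventually_at_filter)
  then show ?thesis using equal by (simp add: DERIV_def)
next
  case greater
  have "((\<lambda>t. exp (- 1 / t) / t ^ k) has_real_derivative
      (exp (- 1 / t) * (1 / t\<^sup>2) * t ^ k - exp (- 1 / t) * (real k * t ^ (k - 1))) / (t ^ k * t ^ k)) (at t)"
    using greater
    by (auto intro!: derivative_eq_intros simp: power2_eq_square)
  moreover have "(exp (- 1 / t) * (1 / t\<^sup>2) * t ^ k - exp (- 1 / t) * (real k * t ^ (k - 1))) / (t ^ k * t ^ k)
      = flat_exp (k + 2) t - real k * flat_exp (k + 1) t"
    using greater by (cases k) (simp_all add: flat_exp_def field_simps power2_eq_square)
  ultimately have "((\<lambda>t. exp (- 1 / t) / t ^ k) has_real_derivative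
      flat_exp (k + 2) t - real k * flat_exp (k + 1) t) (at t)"
    by simp
  then show ?thesis
    by (rule DERIV_cong_ev[THEN iffD1, rotated -1])
       (use greater eventually_nhds_in_open[of "{0<..}" t] in
        \<open>auto simp: flat_exp_def elim!: eventually_mono\<close>)
qed

text \<open>The index \<open>m\<close> is kept general because each derivative raises it by one or
  two; the chain rule contributes only the linear factor \<open>2 * b * (x \<bullet> v)\<close>. All
  cutoffs and bumps below are built from these radial functions.\<close>

lemma Ck_flat_exp_quadratic:
  "Ck k (\<lambda>x::'a::euclidean_space. complex_of_real (flat_exp m (a + b * (x \<bullet> x))))"
proof (induction k arbitrary: m)
  case 0
  have "isCont (flat_exp m) t" for t by (rule DERIV_isCont) (rule flat_exp_has_derivative)
  then have "continuous_on UNIV (flat_exp m)" by (simp add: continuous_at_imp_continuous_on)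
  then show ?case
    by (auto intro!: continuous_intros continuous_on_compose2[of UNIV "flat_exp m"])
next
  case (Suc k)
  let ?u = "\<lambda>x::'a. a + b * (x \<bullet> x)"
  let ?d = "\<lambda>x. flat_exp (m + 2) (?u x) - real m * flat_exp (m + 1) (?u x)"
  have "((\<lambda>x. flat_exp m (?u x)) has_derivative (\<lambda>v. (2 * b * (x \<bullet> v)) * ?d x)) (at x)" for x
    by (rule has_derivative_compose[OF _ flat_exp_has_derivative[unfolded has_field_derivative_def],
          THEN has_derivative_eq_rhs])
       (auto intro!: derivative_eq_intros simp: inner_commute algebra_simps)
  then have "((\<lambda>x. complex_of_real (flat_exp m (?u x))) has_derivative
      (\<lambda>v. complex_of_real ((2 * b * (x \<bullet> v)) * ?d x))) (at x)" for x
    by (rule has_derivative_of_real)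
  moreover have "Ck k (\<lambda>x::'a. complex_of_real ((2 * b * (x \<bullet> v)) * ?d x))" for v
  proof -
    have "bounded_linear (\<lambda>x::'a. complex_of_real (x \<bullet> v))"
      by (rule bounded_linear_compose[OF bounded_linear_of_real bounded_linear_inner_left])
    then have "Ck k (\<lambda>x::'a. complex_of_real (x \<bullet> v))"
      by (rule Ck_bounded_linear)
    then have "Ck k (\<lambda>x::'a. (complex_of_real (2 * b) * complex_of_real (x \<bullet> v)) *
        (complex_of_real (flat_exp (m + 2) (?u x)) -
         complex_of_real (real m) * complex_of_real (flat_exp (m + 1) (?u x))))"
      by (intro Ck_mult Ck_diff Suc Ck_const)
    then show ?thesis by simp
  qed
  ultimately show ?case
    unfolding Ck.simps(2) by (intro exI conjI allI) assumption+
qed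

subsection \<open>Differentiation under the integral sign\<close>

text \<open>The derivative in direction \<open>v\<close> is the integral of the partial derivative
  \<open>G' (x, y) (0, v)\<close>. This is an integral of the same form with a \<open>Ck k\<close>
  function, so the induction closes.\<close>

lemma Ck_parametric_integral_cbox:
  fixes w :: "'a::euclidean_space \<Rightarrow> complex" and G :: "'a \<times> 'b::euclidean_space \<Rightarrow> complex"
  assumes w: "continuous_on UNIV w"
  shows "Ck k G \<Longrightarrow> Ck k (\<lambda>y. integral (cbox a b) (\<lambda>x. G (x, y) * w x))"
proof (induction k arbitrary: G)
  case 0
  then show ?case
    by (auto simp: case_prod_unfold intro!: integral_continuous_on_param continuous_intros
        continuous_on_compose2[OF w] continuous_on_compose2[of UNIV G])
next
  case (Suc k)
  obtain G' where G': "\<And>z. (G has_derivative G' z) (at z)" "\<And>v. Ck k (\<lambda>z. G' z v)"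
    using Suc.prems by auto
  have G_cont: "continuous_on UNIV G" using Ck_continuous[OF Suc.prems] .
  have G'_cont: "continuous_on UNIV (\<lambda>z. G' z v)" for v using Ck_continuous[OF G'(2)] .
  \<comment> \<open>The Leibniz rule asks for the derivative as a bounded linear map depending
    continuously on the parameter and the integration variable; this continuity is checked one
    direction at a time.\<close>
  define D where "D y x = Blinfun (\<lambda>v. G' (x, y) (0, v) * w x)" for x y
  have der: "((\<lambda>y. G (x, y) * w x) has_derivative (\<lambda>v. G' (x, y) (0, v) * w x)) (at y)" for x y
    by (rule has_derivative_mult_left has_derivative_compose[OF _ G'(1)] derivative_eq_intros refl)+
  have D: "blinfun_apply (D y x) = (\<lambda>v. G' (x, y) (0, v) * w x)" for x y
    unfolding D_def using has_derivative_bounded_linear[OF der]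
    by (rule bounded_linear_Blinfun_apply)
  have D_cont: "continuous_on S (\<lambda>(y, x). D y x)" for S
    by (rule continuous_on_blinfun_componentwise)
       (auto simp: case_prod_unfold D intro!: continuous_intros
        continuous_on_compose2[OF w] continuous_on_compose2[OF G'_cont])
  have D_cont': "continuous_on S (D y)" for S y
    using continuous_on_compose2[OF D_cont[of UNIV], of S "\<lambda>x. (y, x)"]
    by (simp add: continuous_on_Pair)
  have "((\<lambda>y. integral (cbox a b) (\<lambda>x. G (x, y) * w x)) has_derivative
      blinfun_apply (integral (cbox a b) (D y))) (at y within UNIV)" for y
    by (rule leibniz_rule)
       (auto simp: D der intro!: D_cont integrable_continuous continuous_intros
        continuous_on_compose2[OF w] continuous_on_compose2[OF G_cont])
  moreover have "blinfun_apply (integral (cbox a b) (D y)) v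
      = integral (cbox a b) (\<lambda>x. G' (x, y) (0, v) * w x)" for y v
    by (subst blinfun_apply_integral) (auto simp: D intro!: integrable_continuous D_cont')
  moreover have "Ck k (\<lambda>y. integral (cbox a b) (\<lambda>x. G' (x, y) (0, v) * w x))" for v
    using Suc.IH[OF G'(2)[of "(0, v)"]] by simp
  ultimately show ?case
    by (auto intro!: exI[of _ "\<lambda>y. blinfun_apply (integral (cbox a b) (D y))"])
qed

lemma integrable_continuous_bounded_support:
  fixes g :: "'a::euclidean_space \<Rightarrow> complex"
  assumes "continuous_on UNIV g" "\<And>x. r < norm x \<Longrightarrow> g x = 0"
  shows "integrable lborel g"
proof -
  have "integrable lborel (\<lambda>x. indicator (cball 0 r) x *\<^sub>R g x)"
    by (intro borel_integrable_compact continuous_on_subset[OF assms(1)]) auto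
  also have "(\<lambda>x. indicator (cball 0 r) x *\<^sub>R g x) = g"
    using assms(2) by (auto simp: indicator_def fun_eq_iff not_le[symmetric])
  finally show ?thesis .
qed

text \<open>The weight \<open>w\<close> lives in a ball, so the integral over the whole space is one
  over a fixed box, the same for all \<open>y\<close>.\<close>

lemma Ck_parametric_integral:
  fixes w :: "'a::euclidean_space \<Rightarrow> complex" and G :: "'a \<times> 'b::euclidean_space \<Rightarrow> complex"
  assumes w: "continuous_on UNIV w" "\<And>x. r < norm x \<Longrightarrow> w x = 0" and G: "Ck k G"
  shows "Ck k (\<lambda>y. LINT x|lborel. G (x, y) * w x)"
proof -
  obtain a b where ab: "cball 0 r \<subseteq> cbox a (b::'a)"
    using bounded_subset_cbox_symmetric[OF bounded_cball] by blast
  have "(LINT x|lborel. G (x, y) * w x) = integral (cbox a b) (\<lambda>x. G (x, y) * w x)" for y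
  proof -
    have "integrable lborel (\<lambda>x. G (x, y) * w x)"
      by (rule integrable_continuous_bounded_support[of _ r])
         (auto simp: w intro!: continuous_intros continuous_on_compose2[OF w(1)]
           continuous_on_compose2[OF Ck_continuous[OF G]])
    then have "(LINT x|lborel. G (x, y) * w x) = integral UNIV (\<lambda>x. G (x, y) * w x)"
      by (rule integral_lborel[symmetric])
    also have "\<dots> = integral UNIV (\<lambda>x. if x \<in> cbox a b then G (x, y) * w x else 0)"
      using ab w(2) by (intro arg_cong[of _ _ "integral UNIV"]) (force simp: fun_eq_iff)
    finally show ?thesis by (simp add: integral_restrict_UNIV)
  qed
  then show ?thesis using Ck_parametric_integral_cbox[OF w(1) G] by simp
qed

subsection \<open>Test functions and their moments\<close>

definition test_fun :: "('a::euclidean_space \<Rightarrow> complex) \<Rightarrow> bool" where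
  "test_fun g \<longleftrightarrow> smooth g \<and> (\<exists>r. \<forall>x. r < norm x \<longrightarrow> g x = 0)"

definition moment :: "('a::euclidean_space \<Rightarrow> nat) \<Rightarrow> ('a \<Rightarrow> complex) \<Rightarrow> complex" where
  "moment \<alpha> g = (LINT x|lborel. g x * complex_of_real (monom_ml \<alpha> x))"

text \<open>Independent factors for the coordinates serve two purposes: halving a single coordinate
  separates moments, and equal factors give the dyadic dilations.\<close>

definition coord_scale :: "('a \<Rightarrow> real) \<Rightarrow> 'a \<Rightarrow> 'a::euclidean_space" where
  "coord_scale c x = (\<Sum>j\<in>Basis. (c j * (x \<bullet> j)) *\<^sub>R j)"

lemma continuous_on_monom_ml: "continuous_on S (monom_ml \<alpha>)"
  unfolding monom_ml_def by (intro continuous_intros)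

lemma test_fun_continuous: "test_fun g \<Longrightarrow> continuous_on UNIV g"
  unfolding test_fun_def smooth_def by (meson Ck_continuous)

lemma test_fun_integrable_moment:
  assumes "test_fun g"
  shows "integrable lborel (\<lambda>x. g x * complex_of_real (monom_ml \<alpha> x))"
proof -
  obtain r where "\<And>x. r < norm x \<Longrightarrow> g x = 0" using assms by (auto simp: test_fun_def)
  then show ?thesis
    by (intro integrable_continuous_bounded_support[of _ r] continuous_intros
        test_fun_continuous[OF assms] continuous_on_monom_ml) auto
qed

lemma test_fun_linear_comb:
  assumes "test_fun f" "test_fun g"
  shows "test_fun (\<lambda>x. a * f x + b * g x)"
proof -
  obtain r r' where r: "\<And>x. r < norm x \<Longrightarrow> f x = 0" "\<And>x. r' < norm x \<Longrightarrow> g x = 0"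
    using assms by (auto simp: test_fun_def)
  have "smooth (\<lambda>x. a * f x + b * g x)"
    using assms unfolding test_fun_def smooth_def by (auto intro!: Ck_add Ck_mult)
  moreover have "\<forall>x. max r r' < norm x \<longrightarrow> a * f x + b * g x = 0" by (simp add: r)
  ultimately show ?thesis unfolding test_fun_def by blast
qed

lemma moment_linear_comb:
  assumes "test_fun f" "test_fun g"
  shows "moment \<alpha> (\<lambda>x. a * f x + b * g x) = a * moment \<alpha> f + b * moment \<alpha> g"
  using test_fun_integrable_moment[OF assms(1)] test_fun_integrable_moment[OF assms(2)]
  by (simp add: moment_def distrib_right mult.assoc)

lemma coord_scale_inner: "j \<in> Basis \<Longrightarrow> coord_scale c x \<bullet> j = c j * (x \<bullet> j)"
  by (simp add: coord_scale_def inner_sum_left inner_Basis if_distrib sum.delta cong: if_cong)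

lemma bounded_linear_coord_scale: "bounded_linear (coord_scale c)"
  unfolding coord_scale_def by (intro bounded_linear_intros)

lemma monom_ml_coord_scale:
  "monom_ml \<alpha> (coord_scale c x) = (\<Prod>j\<in>Basis. c j ^ \<alpha> j) * monom_ml \<alpha> x"
  by (simp add: monom_ml_def coord_scale_inner power_mult_distrib prod.distrib)

lemma test_fun_coord_scale:
  assumes g: "test_fun g" and c: "\<And>j. j \<in> Basis \<Longrightarrow> c j \<noteq> 0"
  shows "test_fun (\<lambda>x. g (coord_scale c x))"
proof -
  obtain r where r: "\<And>x. r < norm x \<Longrightarrow> g x = 0" using g by (auto simp: test_fun_def)
  have inv: "coord_scale (\<lambda>j. inverse (c j)) (coord_scale c x) = x" for x
    by (rule euclidean_eqI) (simp add: coord_scale_inner c)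
  obtain K where K: "K > 0" "\<And>x. norm (coord_scale (\<lambda>j. inverse (c j)) x) \<le> norm x * K"
    using bounded_linear.pos_bounded[OF bounded_linear_coord_scale] by metis
  have "g (coord_scale c x) = 0" if "r * K < norm x" for x
  proof (rule r)
    have "r * K < norm (coord_scale c x) * K" using K(2)[of "coord_scale c x"] that inv by simp
    then show "r < norm (coord_scale c x)" using \<open>K > 0\<close> by simp
  qed
  moreover have "smooth (\<lambda>x. g (coord_scale c x))"
    using g unfolding test_fun_def smooth_def
    by (intro allI Ck_compose_linear[OF bounded_linear_coord_scale]) blast
  ultimately show ?thesis unfolding test_fun_def by blast
qed

text \<open>Change of variables: the Jacobian contributes one factor \<open>c j\<close> per
  coordinate, and the homogeneity of the monomial contributes
  \<open>c j ^ \<alpha> j\<close>.\<close>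

lemma moment_coord_scale:
  assumes g: "test_fun g" and c: "\<And>j. j \<in> Basis \<Longrightarrow> c j > 0"
  shows "moment \<alpha> g =
    complex_of_real (\<Prod>j\<in>Basis. c j ^ (\<alpha> j + 1)) * moment \<alpha> (\<lambda>x. g (coord_scale c x))"
proof -
  let ?h = "\<lambda>x. g x * complex_of_real (monom_ml \<alpha> x)"
  let ?P = "\<Prod>j\<in>Basis. \<bar>c j\<bar>"
  have cont: "continuous_on UNIV ?h"
    by (intro continuous_intros test_fun_continuous[OF g] continuous_on_monom_ml)
  have [measurable]: "?h \<in> borel_measurable borel" by (rule borel_measurable_continuous_onI[OF cont])
  have [measurable]: "coord_scale c \<in> borel_measurable borel"
    by (rule borel_measurable_continuous_onI)
       (simp add: linear_continuous_on bounded_linear_coord_scale)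
  have lb: "lborel = density (distr lborel borel (coord_scale c)) (\<lambda>_. ennreal ?P)"
    using lborel_affine_euclidean[of c 0] c unfolding coord_scale_def by force
  have "moment \<alpha> g = (LINT x|density (distr lborel borel (coord_scale c)) (\<lambda>_. ennreal ?P). ?h x)"
    unfolding moment_def lb[symmetric] ..
  also have "\<dots> = (LINT x|lborel. ?P *\<^sub>R ?h (coord_scale c x))"
    by (subst integral_density) (auto simp: integral_distr prod_nonneg)
  also have "\<dots> = ?P *\<^sub>R (LINT x|lborel. complex_of_real (\<Prod>j\<in>Basis. c j ^ \<alpha> j) *
      (g (coord_scale c x) * complex_of_real (monom_ml \<alpha> x)))"
    by (simp add: monom_ml_coord_scale mult_ac)
  also have "\<dots> = complex_of_real (?P * (\<Prod>j\<in>Basis. c j ^ \<alpha> j)) * moment \<alpha> (\<lambda>x. g (coord_scale c x))"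
    by (simp add: moment_def scaleR_conv_of_real)
  also have "?P * (\<Prod>j\<in>Basis. c j ^ \<alpha> j) = (\<Prod>j\<in>Basis. c j ^ (\<alpha> j + 1))"
    unfolding prod.distrib[symmetric] using c by (intro prod.cong) (simp_all add: less_imp_le)
  finally show ?thesis .
qed

section \<open>Cutoffs and bumps dual to the monomials\<close>

lemma ex_smooth_cutoff:
  obtains \<theta> :: "'a::euclidean_space \<Rightarrow> complex"
  where "smooth \<theta>" "\<And>x. norm x \<le> 1 \<Longrightarrow> \<theta> x = 1" "\<And>x. 2 \<le> norm x \<Longrightarrow> \<theta> x = 0"
    "\<And>x. cmod (\<theta> x) \<le> 1"
proof -
  \<comment> \<open>\<open>u\<close> is positive exactly where \<open>norm x < 2\<close> and
    \<open>v\<close> exactly where \<open>norm x > 1\<close>. Hence \<open>u + v\<close> never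
    vanishes and \<open>u / (u + v)\<close> is the required cutoff.\<close>
  define u v where "u x = flat_exp 0 (4 + (-1) * (x \<bullet> x))" and "v x = flat_exp 0 (-1 + 1 * (x \<bullet> x))"
    for x :: 'a
  define \<theta> where "\<theta> x = complex_of_real (u x) * inverse (complex_of_real (u x) + complex_of_real (v x))"
    for x
  have nonneg: "0 \<le> u x" "0 \<le> v x" for x by (simp_all add: u_def v_def flat_exp_nonneg)
  have pos: "0 < u x + v x" for x
  proof (cases "x \<bullet> x < 4")
    case True
    then show ?thesis using nonneg(2)[of x] flat_exp_pos[of "4 - x \<bullet> x" 0] by (simp add: u_def)
  next
    case False
    then show ?thesis using nonneg(1)[of x] flat_exp_pos[of "-1 + x \<bullet> x" 0] by (simp add: v_def)
  qed
  have ne: "complex_of_real (u x) + complex_of_real (v x) \<noteq> 0" for x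
    using pos[of x] by (metis of_real_add of_real_eq_0_iff less_irrefl)
  have "smooth \<theta>"
    unfolding smooth_def \<theta>_def
    by (intro allI Ck_mult Ck_inverse Ck_add ne) (simp_all only: u_def v_def Ck_flat_exp_quadratic)
  moreover have "\<theta> x = 1" if "norm x \<le> 1" for x
  proof -
    have "x \<bullet> x \<le> 1" using that by (simp add: dot_square_norm power_le_one)
    then have "v x = 0" by (simp add: v_def)
    then show ?thesis using ne[of x] by (simp add: \<theta>_def)
  qed
  moreover have "\<theta> x = 0" if "2 \<le> norm x" for x
  proof -
    have "2\<^sup>2 \<le> x \<bullet> x" using that by (simp only: dot_square_norm power_mono)
    then show ?thesis by (simp add: \<theta>_def u_def)
  qed
  moreover have "cmod (\<theta> x) \<le> 1" for x
  proof -
    have "cmod (\<theta> x) = u x / (u x + v x)"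
      using nonneg[of x] pos[of x]
      by (simp add: \<theta>_def norm_mult norm_inverse divide_inverse flip: of_real_add)
    also have "\<dots> \<le> 1" using nonneg[of x] pos[of x] by simp
    finally show ?thesis .
  qed
  ultimately show thesis using that by blast
qed

text \<open>A bump is placed in the unit ball about the point with all coordinates equal to 2. Every
  coordinate is at least 1 there, so all monomials are positive on the support and no moment can
  cancel.\<close>

lemma ex_test_fun_nonzero_moments:
  obtains \<eta> :: "'a::euclidean_space \<Rightarrow> complex" where "test_fun \<eta>" "\<And>\<alpha>. moment \<alpha> \<eta> \<noteq> 0"
proof -
  define c :: 'a where "c = 2 *\<^sub>R One"
  define h where "h x = flat_exp 0 (1 + (-1) * ((x - c) \<bullet> (x - c)))" for x :: 'a
  define \<eta> where "\<eta> x = complex_of_real (h x)" for x :: 'a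
  have h0: "h x = 0" if "1 \<le> norm (x - c)" for x
    using that by (simp add: h_def dot_square_norm)
  have coord: "1 \<le> x \<bullet> b" if "norm (x - c) < 1" "b \<in> Basis" for x b
  proof -
    have "\<bar>(x - c) \<bullet> b\<bar> < 1" using Basis_le_norm[OF that(2), of "x - c"] that(1) by linarith
    then show ?thesis using that(2) by (simp add: c_def inner_diff_left)
  qed
  have sm: "smooth \<eta>"
    unfolding smooth_def
  proof
    fix k
    have "Ck k (\<lambda>x::'a. complex_of_real (flat_exp 0 (1 + (-1) * ((- c + x) \<bullet> (- c + x)))))"
      by (rule Ck_compose_affine[where L = "\<lambda>x. x",
            of k "\<lambda>x. complex_of_real (flat_exp 0 (1 + (-1) * (x \<bullet> x)))"])
         (rule bounded_linear_ident Ck_flat_exp_quadratic)+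
    then show "Ck k \<eta>" unfolding \<eta>_def h_def by (simp add: algebra_simps)
  qed
  have tf: "test_fun \<eta>"
    unfolding test_fun_def
  proof (intro conjI sm exI allI impI)
    fix x :: 'a assume "norm c + 1 < norm x"
    then show "\<eta> x = 0" using h0[of x] norm_triangle_ineq2[of x c] by (simp add: \<eta>_def)
  qed
  moreover have "moment \<alpha> \<eta> \<noteq> 0" for \<alpha>
  proof
    assume "moment \<alpha> \<eta> = 0"
    let ?g = "\<lambda>x. h x * monom_ml \<alpha> x"
    have "integrable lborel (\<lambda>x. complex_of_real (?g x))"
      using test_fun_integrable_moment[OF tf, of \<alpha>] by (simp add: \<eta>_def)
    then have int: "integrable lborel ?g" by (simp only: complex_of_real_integrable_eq)
    have "(LINT x|lborel. ?g x) = 0"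
      using \<open>moment \<alpha> \<eta> = 0\<close> integral_complex_of_real[of lborel ?g] by (simp add: moment_def \<eta>_def)
    moreover have nn: "0 \<le> ?g x" for x
    proof (cases "norm (x - c) < 1")
      case True
      then have "0 \<le> monom_ml \<alpha> x"
        unfolding monom_ml_def using coord[OF True] by (intro prod_nonneg zero_le_power) force
      then show ?thesis by (simp add: h_def flat_exp_nonneg)
    qed (simp add: h0)
    ultimately have "AE x in lborel. ?g x = 0"
      using integral_nonneg_eq_0_iff_AE[OF int] by simp
    \<comment> \<open>The integrand is continuous, so vanishing almost everywhere forces it to
      vanish at the centre \<open>c\<close> too, where it is positive.\<close>
    then have "AE x in lebesgue. x \<in> UNIV \<longrightarrow> x \<in> {x. ?g x = 0}" by (auto intro: AE_completion)
    moreover have "closed {x. ?g x = 0}"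
    proof -
      have "continuous_on UNIV (\<lambda>x. Re (\<eta> x) * monom_ml \<alpha> x)"
        by (intro continuous_intros test_fun_continuous tf continuous_on_monom_ml)
      then have "continuous_on UNIV ?g" by (simp add: \<eta>_def)
      then show ?thesis
        using closed_Collect_eq[of ?g "\<lambda>_. 0"] by simp
    qed
    ultimately have "?g c = 0"
      using mem_closed_if_AE_lebesgue_open[of UNIV "{x. ?g x = 0}" c] by simp
    moreover have "h c > 0" by (simp add: h_def flat_exp_pos)
    moreover have "monom_ml \<alpha> c > 0"
      unfolding monom_ml_def by (intro prod_pos zero_less_power) (simp add: c_def)
    ultimately show False by simp
  qed
  ultimately show thesis using that by blast
qed

text \<open>
  Halving the \<open>b\<close>-th coordinate multiplies the \<open>\<beta>\<close>-moment by \<open>2 ^ (\<beta> b + 1)\<close>, so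
  subtracting \<open>2 ^ (l + 1) * \<phi>\<close> kills exactly the moments with \<open>\<beta> b = l\<close>.
\<close>

lemma ex_test_fun_dual_monomial:
  fixes \<alpha> :: "'a::euclidean_space \<Rightarrow> nat"
  obtains \<phi> where "test_fun \<phi>" "moment \<alpha> \<phi> = 1"
    "\<And>\<beta>. \<forall>j\<in>Basis. \<beta> j \<le> s \<Longrightarrow> \<exists>b\<in>Basis. \<beta> b \<noteq> \<alpha> b \<Longrightarrow> moment \<beta> \<phi> = 0"
proof -
  have ex: "\<exists>\<phi>. test_fun \<phi> \<and> moment \<alpha> \<phi> \<noteq> 0 \<and> (\<forall>x\<in>F. \<forall>\<beta>. \<beta> (fst x) = snd x \<longrightarrow> moment \<beta> \<phi> = 0)"
    if "finite F" "\<forall>x\<in>F. fst x \<in> Basis \<and> snd x \<noteq> \<alpha> (fst x)" for F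
    using that
  proof (induction F rule: finite_induct)
    case empty
    obtain \<eta> :: "'a \<Rightarrow> complex" where "test_fun \<eta>" "\<And>\<alpha>. moment \<alpha> \<eta> \<noteq> 0"
      by (rule ex_test_fun_nonzero_moments) blast
    then show ?case by (intro exI[of _ \<eta>]) simp
  next
    case (insert x F)
    define b l where "b = fst x" and "l = snd x"
    have b: "b \<in> Basis" "l \<noteq> \<alpha> b" using insert.prems by (simp_all add: b_def l_def)
    have "\<exists>\<phi>. test_fun \<phi> \<and> moment \<alpha> \<phi> \<noteq> 0 \<and> (\<forall>x\<in>F. \<forall>\<beta>. \<beta> (fst x) = snd x \<longrightarrow> moment \<beta> \<phi> = 0)"
      using insert.prems by (intro insert.IH) simp
    then obtain \<phi> where \<phi>: "test_fun \<phi>" "moment \<alpha> \<phi> \<noteq> 0"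
      and \<phi>0: "\<forall>x\<in>F. \<forall>\<beta>. \<beta> (fst x) = snd x \<longrightarrow> moment \<beta> \<phi> = 0"
      by (elim exE conjE)
    define c where "c j = (if j = b then 1 / 2 else 1 :: real)" for j
    have c_pos: "0 < c j" for j by (simp add: c_def)
    define \<psi> where "\<psi> x = 1 * \<phi> (coord_scale c x) + (- (2 ^ (l + 1))) * \<phi> x" for x
    have tf: "test_fun (\<lambda>x. \<phi> (coord_scale c x))"
      by (rule test_fun_coord_scale[OF \<phi>(1)]) (simp add: c_def)
    have "moment \<beta> (\<lambda>x. \<phi> (coord_scale c x)) = 2 ^ (\<beta> b + 1) * moment \<beta> \<phi>" for \<beta>
    proof -
      have "(\<Prod>j\<in>Basis. c j ^ (\<beta> j + 1)) = (\<Prod>j\<in>Basis. if j = b then (1 / 2) ^ (\<beta> b + 1) else 1)"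
        by (rule prod.cong) (auto simp: c_def)
      also have "\<dots> = (1 / 2) ^ (\<beta> b + 1)" using b by (simp add: prod.delta)
      finally have "moment \<beta> \<phi> = (1 / 2) ^ (\<beta> b + 1) * moment \<beta> (\<lambda>x. \<phi> (coord_scale c x))"
        using moment_coord_scale[of \<phi> c \<beta>, OF \<phi>(1) c_pos] by (simp only: of_real_power) simp
      then show ?thesis by (simp add: power_one_over)
    qed
    then have mom: "moment \<beta> \<psi> = (2 ^ (\<beta> b + 1) - 2 ^ (l + 1)) * moment \<beta> \<phi>" for \<beta>
      unfolding \<psi>_def moment_linear_comb[OF tf \<phi>(1)] by (simp add: algebra_simps)
    have "(2::complex) ^ (\<alpha> b + 1) \<noteq> 2 ^ (l + 1)"
    proof
      assume "(2::complex) ^ (\<alpha> b + 1) = 2 ^ (l + 1)"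
      then have "cmod (2 ^ (\<alpha> b + 1)) = cmod (2 ^ (l + 1))" by simp
      then show False using b(2) by (simp add: norm_power)
    qed
    then have "moment \<alpha> \<psi> \<noteq> 0" using \<phi>(2) mom by simp
    moreover have "test_fun \<psi>" unfolding \<psi>_def by (rule test_fun_linear_comb[OF tf \<phi>(1)])
    moreover have "moment \<beta> \<psi> = 0" if "y \<in> insert x F" "\<beta> (fst y) = snd y" for y \<beta>
      using that \<phi>0 by (cases "y = x") (simp_all add: mom b_def l_def)
    ultimately show ?case by (intro exI[of _ \<psi>]) simp
  qed
  \<comment> \<open>The pairs of a coordinate and a wrong exponent at most \<open>s\<close>. Every
    \<beta> with exponents at most \<open>s\<close> that differs from \<alpha> on
    \<open>Basis\<close> meets one of these finitely many pairs.\<close>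
  define F where "F = {x \<in> (Basis :: 'a set) \<times> {..s}. snd x \<noteq> \<alpha> (fst x)}"
  have "\<exists>\<phi>. test_fun \<phi> \<and> moment \<alpha> \<phi> \<noteq> 0 \<and> (\<forall>x\<in>F. \<forall>\<beta>. \<beta> (fst x) = snd x \<longrightarrow> moment \<beta> \<phi> = 0)"
    by (rule ex) (auto simp: F_def)
  then obtain \<phi> where \<phi>: "test_fun \<phi>" "moment \<alpha> \<phi> \<noteq> 0"
    and \<phi>0: "\<forall>x\<in>F. \<forall>\<beta>. \<beta> (fst x) = snd x \<longrightarrow> moment \<beta> \<phi> = 0"
    by (elim exE conjE)
  have \<phi>0: "moment \<beta> \<phi> = 0" if "b \<in> Basis" "\<beta> b \<le> s" "\<beta> b \<noteq> \<alpha> b" for \<beta> b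
    using bspec[OF \<phi>0, of "(b, \<beta> b)"] that by (simp add: F_def)
  define \<psi> where "\<psi> x = (1 / moment \<alpha> \<phi>) * \<phi> x + 0 * \<phi> x" for x
  have mom: "moment \<beta> \<psi> = moment \<beta> \<phi> / moment \<alpha> \<phi>" for \<beta>
    unfolding \<psi>_def moment_linear_comb[OF \<phi>(1) \<phi>(1)] by simp
  show thesis
  proof (rule that)
    show "test_fun \<psi>" unfolding \<psi>_def by (rule test_fun_linear_comb[OF \<phi>(1) \<phi>(1)])
    show "moment \<alpha> \<psi> = 1" using \<phi>(2) by (simp add: mom)
    fix \<beta> :: "'a \<Rightarrow> nat"
    assume "\<forall>j\<in>Basis. \<beta> j \<le> s" "\<exists>b\<in>Basis. \<beta> b \<noteq> \<alpha> b"
    then obtain b where "b \<in> Basis" "\<beta> b \<le> s" "\<beta> b \<noteq> \<alpha> b" by blast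
    then show "moment \<beta> \<psi> = 0" using \<phi>0[of b \<beta>] by (simp add: mom)
  qed
qed

text \<open>Values off \<open>Basis\<close> do not affect \<open>monom_ml\<close>; fixing them to 0
  makes the set finite and lets distinct members differ on \<open>Basis\<close>.\<close>

definition multi_indices :: "nat \<Rightarrow> ('a::euclidean_space \<Rightarrow> nat) set" where
  "multi_indices s = {\<alpha>. (\<forall>b. b \<notin> Basis \<longrightarrow> \<alpha> b = 0) \<and> mi_order \<alpha> \<le> s}"

lemma mi_order_component_le: "b \<in> Basis \<Longrightarrow> \<alpha> b \<le> mi_order \<alpha>"
  unfolding mi_order_def by (rule member_le_sum) auto

lemma finite_multi_indices: "finite (multi_indices s)"
proof (rule finite_subset)
  show "multi_indices s \<subseteq> {\<alpha>. \<forall>b. (b \<in> Basis \<longrightarrow> \<alpha> b \<in> {..s}) \<and> (b \<notin> Basis \<longrightarrow> \<alpha> b = 0)}"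
    using mi_order_component_le order_trans unfolding multi_indices_def by fastforce
  show "finite {\<alpha>. \<forall>b::'a. (b \<in> Basis \<longrightarrow> \<alpha> b \<in> {..s}) \<and> (b \<notin> Basis \<longrightarrow> \<alpha> b = 0)}"
    by (rule finite_set_of_finite_funs) auto
qed

lemma monom_ml_cong: "(\<And>b. b \<in> Basis \<Longrightarrow> \<alpha> b = \<beta> b) \<Longrightarrow> monom_ml \<alpha> = monom_ml \<beta>"
  unfolding monom_ml_def by (intro ext prod.cong) auto

lemma ex_multi_index:
  assumes "mi_order \<beta> \<le> s"
  obtains \<alpha> where "\<alpha> \<in> multi_indices s" "\<And>b. b \<in> Basis \<Longrightarrow> \<alpha> b = \<beta> b" "moment \<alpha> = moment \<beta>"
proof
  define \<alpha> where "\<alpha> b = (if b \<in> Basis then \<beta> b else 0)" for b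
  show "\<alpha> \<in> multi_indices s" using assms by (simp add: multi_indices_def mi_order_def \<alpha>_def)
  show "\<alpha> b = \<beta> b" if "b \<in> Basis" for b using that by (simp add: \<alpha>_def)
  then show "moment \<alpha> = moment \<beta>" unfolding moment_def using monom_ml_cong[of \<alpha> \<beta>] by presburger
qed

lemma abs_monom_ml_le: "\<bar>monom_ml \<alpha> x\<bar> \<le> norm x ^ mi_order \<alpha>"
proof -
  have "\<bar>monom_ml \<alpha> x\<bar> = (\<Prod>i\<in>Basis. \<bar>x \<bullet> i\<bar> ^ \<alpha> i)"
    by (simp add: monom_ml_def abs_prod power_abs)
  also have "\<dots> \<le> (\<Prod>i\<in>Basis. norm x ^ \<alpha> i)"
    by (intro prod_mono conjI power_mono zero_le_power Basis_le_norm) auto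
  also have "\<dots> = norm x ^ mi_order \<alpha>" by (simp add: mi_order_def power_sum)
  finally show ?thesis .
qed

section \<open>Linear combinations of test functions and their moments\<close>

lemma test_fun_mult_smooth:
  assumes "test_fun f" "smooth g"
  shows "test_fun (\<lambda>x. g x * f x)"
  using assms unfolding test_fun_def smooth_def by (auto intro!: Ck_mult)

lemma test_fun_sum:
  assumes "\<And>k. k \<in> F \<Longrightarrow> test_fun (g k)"
  shows "test_fun (\<lambda>x. \<Sum>k\<in>F. c k * g k x)"
  using assms
proof (induction F rule: infinite_finite_induct)
  case (insert k F)
  then show ?case using test_fun_linear_comb[of "g k" "\<lambda>x. \<Sum>k\<in>F. c k * g k x" "c k" 1] by simp
qed (auto simp: test_fun_def smooth_def)

lemma moment_sum:
  assumes "\<And>k. k \<in> F \<Longrightarrow> test_fun (g k)"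
  shows "moment \<beta> (\<lambda>x. \<Sum>k\<in>F. c k * g k x) = (\<Sum>k\<in>F. c k * moment \<beta> (g k))"
  using assms
proof (induction F rule: infinite_finite_induct)
  case (insert k F)
  then show ?case
    using moment_linear_comb[of "g k" "\<lambda>x. \<Sum>k\<in>F. c k * g k x" \<beta> "c k" 1] test_fun_sum[of F g c]
    by simp
qed (auto simp: moment_def)

lemma moment_diff_sum:
  assumes "test_fun f" "\<And>k. k \<in> F \<Longrightarrow> test_fun (g k)"
  shows "moment \<beta> (\<lambda>x. a * f x - (\<Sum>k\<in>F. c k * g k x)) =
    a * moment \<beta> f - (\<Sum>k\<in>F. c k * moment \<beta> (g k))"
  using moment_linear_comb[where \<alpha> = \<beta> and a = a and b = "-1", OF assms(1) test_fun_sum[of F g c, OF assms(2)]]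
    moment_sum[of F g \<beta> c, OF assms(2)]
  by simp

section \<open>Slices and partial moments of functions of two variables\<close>

lemma Dspace_iff:
  "f \<in> Dspace s1 s2 \<longleftrightarrow> test_fun (\<lambda>z. f (fst z) (snd z)) \<and>
    (\<forall>y \<alpha>. mi_order \<alpha> \<le> s1 \<longrightarrow> moment \<alpha> (\<lambda>x. f x y) = 0) \<and>
    (\<forall>x \<alpha>. mi_order \<alpha> \<le> s2 \<longrightarrow> moment \<alpha> (f x) = 0)"
proof -
  have "compact (closure {z. f (fst z) (snd z) \<noteq> 0}) \<longleftrightarrow>
      (\<exists>r. \<forall>z. r < norm z \<longrightarrow> f (fst z) (snd z) = 0)"
    unfolding compact_closure bounded_iff by (auto simp: not_le[symmetric])
  then show ?thesis by (simp add: Dspace_def test_fun_def moment_def)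
qed

lemma test_fun_slice1:
  assumes "test_fun (\<lambda>z. f (fst z) (snd z))"
  shows "test_fun (\<lambda>x. f x y)"
proof -
  obtain r where r: "\<And>z. r < norm z \<Longrightarrow> f (fst z) (snd z) = 0" using assms unfolding test_fun_def by blast
  have "f x y = 0" if "r < norm x" for x
    using r[of "(x, y)"] that norm_fst_le[of x y] by simp
  moreover have "Ck k (\<lambda>x. f x y)" for k
    using Ck_compose_affine[of "\<lambda>x. (x, 0)" k "\<lambda>z. f (fst z) (snd z)" "(0, y)"] assms
    by (simp add: test_fun_def smooth_def bounded_linear_Pair bounded_linear_ident)
  ultimately show ?thesis unfolding test_fun_def smooth_def by blast
qed

lemma test_fun_swap:
  assumes "test_fun (\<lambda>z. f (fst z) (snd z))"
  shows "test_fun (\<lambda>z. f (snd z) (fst z))"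
proof -
  obtain r where r: "\<And>z. r < norm z \<Longrightarrow> f (fst z) (snd z) = 0" using assms unfolding test_fun_def by blast
  have "f (snd z) (fst z) = 0" if "r < norm z" for z
    using r[of "(snd z, fst z)"] that by (simp add: norm_prod_def add.commute)
  moreover have "Ck k (\<lambda>z. f (snd z) (fst z))" for k
    using Ck_compose_linear[of "\<lambda>z. (snd z, fst z)" k "\<lambda>z. f (fst z) (snd z)"] assms
    by (simp add: test_fun_def smooth_def bounded_linear_Pair bounded_linear_fst bounded_linear_snd)
  ultimately show ?thesis unfolding test_fun_def smooth_def by blast
qed

lemma Dspace_swap: "f \<in> Dspace s1 s2 \<Longrightarrow> (\<lambda>y x. f x y) \<in> Dspace s2 s1"
  unfolding Dspace_iff by (simp add: test_fun_swap)

lemma test_fun_slice2: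
  assumes "test_fun (\<lambda>z. f (fst z) (snd z))"
  shows "test_fun (f x)"
  using test_fun_slice1[of "\<lambda>y x. f x y" x] test_fun_swap[OF assms] by simp

lemma Dspace_linear_comb:
  assumes "f \<in> Dspace s1 s2" "g \<in> Dspace s1 s2"
  shows "(\<lambda>x y. a * f x y + b * g x y) \<in> Dspace s1 s2"
  using assms unfolding Dspace_iff
  by (simp add: test_fun_linear_comb moment_linear_comb test_fun_slice1 test_fun_slice2)

text \<open>With \<open>g\<close> a cutoff, these are the coefficients of the corrected truncation
  as functions of the other variable. Smoothness comes from differentiation under the integral with
  \<open>g\<close> times the monomial as the weight; the support in \<open>y\<close> is inherited
  from \<open>f\<close>.\<close>

lemma test_fun_moment_slice:
  assumes f: "test_fun (\<lambda>z. f (fst z) (snd z))" and g: "smooth g" "\<And>x. r < norm x \<Longrightarrow> g x = 0"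
  shows "test_fun (\<lambda>y. moment \<alpha> (\<lambda>x. g x * f x y))"
proof -
  obtain r' where r': "\<And>z. r' < norm z \<Longrightarrow> f (fst z) (snd z) = 0" using f unfolding test_fun_def by blast
  have "f x y = 0" if "r' < norm y" for x y
    using r'[of "(x, y)"] that norm_snd_le[of y x] by simp
  then have "moment \<alpha> (\<lambda>x. g x * f x y) = 0" if "r' < norm y" for y
    using that by (simp add: moment_def)
  moreover have "Ck k (\<lambda>y. moment \<alpha> (\<lambda>x. g x * f x y))" for k
  proof -
    have "continuous_on UNIV g" using g(1) Ck_continuous by (auto simp: smooth_def)
    then have "continuous_on UNIV (\<lambda>x. g x * complex_of_real (monom_ml \<alpha> x))"
      by (intro continuous_intros continuous_on_monom_ml)
    then have "Ck k (\<lambda>y. LINT x|lborel. f (fst (x, y)) (snd (x, y)) *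
        (g x * complex_of_real (monom_ml \<alpha> x)))"
      using f g(2) by (intro Ck_parametric_integral[of _ r]) (auto simp: test_fun_def smooth_def)
    then show ?thesis by (simp add: moment_def mult_ac)
  qed
  ultimately show ?thesis unfolding test_fun_def smooth_def by blast
qed

text \<open>By Fubini the integration in \<open>y\<close> may be done first, and it yields a
  \<beta>-moment of \<open>f x\<close>. Thus correcting moments in the first variable preserves the
  cancellation in the second.\<close>

lemma moment_moment_slice_eq_0:
  assumes f: "test_fun (\<lambda>z. f (fst z) (snd z))" and g: "smooth g"
    and 0: "\<And>x. moment \<beta> (f x) = 0"
  shows "moment \<beta> (\<lambda>y. moment \<alpha> (\<lambda>x. g x * f x y)) = 0"
proof -
  define F where "F x y = g x * f x y * complex_of_real (monom_ml \<alpha> x) * complex_of_real (monom_ml \<beta> y)"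
    for x y
  obtain r where r: "\<And>z. r < norm z \<Longrightarrow> f (fst z) (snd z) = 0" using f unfolding test_fun_def by blast
  have gc: "continuous_on UNIV g" using g Ck_continuous by (auto simp: smooth_def)
  have "continuous_on UNIV (\<lambda>z. F (fst z) (snd z))"
    unfolding F_def
    by (intro continuous_intros test_fun_continuous[OF f] continuous_on_compose2[OF gc]
        continuous_on_compose2[OF continuous_on_monom_ml[of UNIV]]) auto
  then have "integrable lborel (\<lambda>z. F (fst z) (snd z))"
    by (rule integrable_continuous_bounded_support[of _ r]) (simp add: F_def r)
  then have "integrable (lborel \<Otimes>\<^sub>M lborel) (case_prod F)"
    by (simp add: lborel_prod case_prod_unfold)
  then have "(LINT y|lborel. LINT x|lborel. F x y) = (LINT x|lborel. LINT y|lborel. F x y)"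
    by (rule lborel_pair.Fubini_integral)
  moreover have "moment \<beta> (\<lambda>y. moment \<alpha> (\<lambda>x. g x * f x y)) = (LINT y|lborel. LINT x|lborel. F x y)"
    by (simp add: moment_def F_def)
  moreover have "(LINT y|lborel. F x y) = 0" for x
  proof -
    have "(LINT y|lborel. F x y) = (LINT y|lborel. (g x * complex_of_real (monom_ml \<alpha> x)) *
        (f x y * complex_of_real (monom_ml \<beta> y)))"
      by (simp add: F_def mult_ac)
    also have "\<dots> = (g x * complex_of_real (monom_ml \<alpha> x)) * moment \<beta> (f x)"
      by (simp add: moment_def)
    finally show ?thesis by (simp add: 0)
  qed
  ultimately show ?thesis by simp
qed

subsection \<open>The dyadic blocks\<close>

text \<open>The data for one variable: a cutoff together with bumps dual to the monomials, all of
  them with a common support radius \<open>R\<close> and a common bound \<open>B\<close>. With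
  \<open>2 \<le> R\<close>, the ball of radius \<open>R * 2 ^ i\<close> contains the supports of
  both the cutoff and the bumps at scale \<open>2 ^ i\<close>.\<close>

locale dyadic_cutoff =
  fixes \<theta> :: "'a::euclidean_space \<Rightarrow> complex" and \<phi> :: "('a \<Rightarrow> nat) \<Rightarrow> 'a \<Rightarrow> complex"
    and s :: nat and R B :: real
  assumes smooth_\<theta>: "smooth \<theta>"
    and \<theta>_eq_1: "norm x \<le> 1 \<Longrightarrow> \<theta> x = 1"
    and \<theta>_eq_0: "2 \<le> norm x \<Longrightarrow> \<theta> x = 0"
    and \<theta>_le_1: "cmod (\<theta> x) \<le> 1"
    and test_fun_\<phi>: "\<alpha> \<in> multi_indices s \<Longrightarrow> test_fun (\<phi> \<alpha>)"
    and \<phi>_eq_0: "\<alpha> \<in> multi_indices s \<Longrightarrow> R < norm x \<Longrightarrow> \<phi> \<alpha> x = 0"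
    and \<phi>_le: "\<alpha> \<in> multi_indices s \<Longrightarrow> cmod (\<phi> \<alpha> x) \<le> B"
    and \<phi>_dual: "\<alpha> \<in> multi_indices s \<Longrightarrow> \<beta> \<in> multi_indices s \<Longrightarrow>
      moment \<beta> (\<phi> \<alpha>) = (if \<alpha> = \<beta> then 1 else 0)"
    and R_ge: "2 \<le> R" and B_nonneg: "0 \<le> B"
begin

definition cutoff :: "nat \<Rightarrow> 'a \<Rightarrow> complex" where
  "cutoff i x = \<theta> ((1 / 2 ^ i) *\<^sub>R x)"

text \<open>The power of \<open>1 / 2 ^ i\<close> compensates the effect of the dilation on the
  \<alpha>-moment, so that duality to the monomials persists at every scale.\<close>

definition corrector :: "nat \<Rightarrow> ('a \<Rightarrow> nat) \<Rightarrow> 'a \<Rightarrow> complex" where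
  "corrector i \<alpha> x = (1 / 2 ^ i) ^ (mi_order \<alpha> + DIM('a)) * \<phi> \<alpha> ((1 / 2 ^ i) *\<^sub>R x)"

definition proj :: "nat \<Rightarrow> ('a \<Rightarrow> complex) \<Rightarrow> 'a \<Rightarrow> complex" where
  "proj i h x = cutoff i x * h x -
    (\<Sum>\<alpha>\<in>multi_indices s. moment \<alpha> (\<lambda>u. cutoff i u * h u) * corrector i \<alpha> x)"

text \<open>The block of index 0 is all of \<open>proj 0 h\<close>, so the partial sums telescope to
  \<open>proj m h\<close> with nothing left over.\<close>

definition block :: "nat \<Rightarrow> ('a \<Rightarrow> complex) \<Rightarrow> 'a \<Rightarrow> complex" where
  "block i h x = proj i h x - (if i = 0 then 0 else proj (i - 1) h x)"

lemma sum_block: "(\<Sum>i\<le>m. block i h x) = proj m h x"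
  by (induction m) (simp_all add: block_def)

lemma smooth_cutoff: "smooth (cutoff i)"
  using smooth_\<theta> unfolding smooth_def cutoff_def
  by (intro allI Ck_compose_linear[OF bounded_linear_scaleR_right]) blast

lemma cutoff_eq_1: "norm x \<le> 2 ^ i \<Longrightarrow> cutoff i x = 1"
  by (simp add: cutoff_def \<theta>_eq_1)

lemma cutoff_eq_0: "2 * 2 ^ i \<le> norm x \<Longrightarrow> cutoff i x = 0"
  by (simp add: cutoff_def \<theta>_eq_0 field_simps)

lemma cutoff_le_1: "cmod (cutoff i x) \<le> 1"
  by (simp add: cutoff_def \<theta>_le_1)

lemma test_fun_cutoff_mult: "test_fun h \<Longrightarrow> test_fun (\<lambda>x. cutoff i x * h x)"
  by (simp add: test_fun_mult_smooth smooth_cutoff)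

lemma scaleR_eq_coord_scale: "c *\<^sub>R x = coord_scale (\<lambda>_. c) (x::'a)"
  by (rule euclidean_eqI) (simp add: coord_scale_inner)

lemma corrector_eq_0: "\<alpha> \<in> multi_indices s \<Longrightarrow> R * 2 ^ i < norm x \<Longrightarrow> corrector i \<alpha> x = 0"
  by (simp add: corrector_def \<phi>_eq_0 field_simps)

lemma corrector_le:
  assumes "\<alpha> \<in> multi_indices s"
  shows "cmod (corrector i \<alpha> x) \<le> (1 / 2 ^ i) ^ (mi_order \<alpha> + DIM('a)) * B"
  using \<phi>_le[OF assms] by (simp add: corrector_def norm_mult norm_power norm_divide mult_left_mono)

text \<open>Dilating \<open>\<phi> \<alpha>\<close> multiplies its \<beta>-moment by
  \<open>(2 ^ i) ^ (mi_order \<beta> + DIM('a))\<close>. For \<beta> equal to \<alpha> the prefactor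
  of \<open>corrector\<close> cancels this; for any other \<beta> the moment is 0 before and
  after.\<close>

lemma
  assumes "\<alpha> \<in> multi_indices s"
  shows test_fun_corrector: "test_fun (corrector i \<alpha>)"
    and moment_corrector: "\<beta> \<in> multi_indices s \<Longrightarrow> moment \<beta> (corrector i \<alpha>) = (if \<alpha> = \<beta> then 1 else 0)"
proof -
  let ?c = "\<lambda>_::'a. (1 / 2 ^ i :: real)"
  let ?a = "(1 / 2 ^ i) ^ (mi_order \<alpha> + DIM('a)) :: complex"
  have tf: "test_fun (\<lambda>x. \<phi> \<alpha> (coord_scale ?c x))"
    by (rule test_fun_coord_scale[OF test_fun_\<phi>[OF assms]]) simp
  have eq: "corrector i \<alpha> = (\<lambda>x. ?a * \<phi> \<alpha> (coord_scale ?c x) + 0 * \<phi> \<alpha> (coord_scale ?c x))"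
    by (simp add: corrector_def scaleR_eq_coord_scale fun_eq_iff)
  show "test_fun (corrector i \<alpha>)" unfolding eq by (rule test_fun_linear_comb[OF tf tf])
  have mom: "moment \<beta> (corrector i \<alpha>) = ?a * moment \<beta> (\<lambda>x. \<phi> \<alpha> (coord_scale ?c x))" for \<beta>
    unfolding eq by (subst moment_linear_comb[OF tf tf]) simp
  have "moment \<beta> (\<phi> \<alpha>) =
      complex_of_real (\<Prod>j\<in>(Basis::'a set). (1 / 2 ^ i) ^ (\<beta> j + 1)) * moment \<beta> (\<lambda>x. \<phi> \<alpha> (coord_scale ?c x))" for \<beta>
    by (rule moment_coord_scale[OF test_fun_\<phi>[OF assms]]) simp
  moreover have "(\<Prod>j\<in>(Basis::'a set). (1 / 2 ^ i) ^ (\<beta> j + 1)) = (1 / 2 ^ i :: real) ^ (mi_order \<beta> + DIM('a))" for \<beta>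
    unfolding power_sum[symmetric] sum.distrib by (simp add: mi_order_def)
  ultimately have "moment \<beta> (\<phi> \<alpha>) = complex_of_real ((1 / 2 ^ i) ^ (mi_order \<beta> + DIM('a))) *
      moment \<beta> (\<lambda>x. \<phi> \<alpha> (coord_scale ?c x))" for \<beta>
    by (simp only:)
  then have m: "moment \<beta> (\<phi> \<alpha>) =
      (1 / 2 ^ i) ^ (mi_order \<beta> + DIM('a)) * moment \<beta> (\<lambda>x. \<phi> \<alpha> (coord_scale ?c x))" for \<beta>
    by simp
  show "moment \<beta> (corrector i \<alpha>) = (if \<alpha> = \<beta> then 1 else 0)" if "\<beta> \<in> multi_indices s"
  proof (cases "\<alpha> = \<beta>")
    case True
    then show ?thesis using mom[of \<beta>] m[of \<beta>] \<phi>_dual[OF assms that] by simp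
  next
    case False
    then have "moment \<beta> (\<lambda>x. \<phi> \<alpha> (coord_scale ?c x)) = 0" using m[of \<beta>] \<phi>_dual[OF assms that] by simp
    then show ?thesis using mom[of \<beta>] False by simp
  qed
qed

text \<open>By duality only one term of the correction has a nonzero \<alpha>-moment, and it cancels
  that of the truncated function.\<close>

lemma moment_proj:
  assumes h: "test_fun h" and \<beta>: "mi_order \<beta> \<le> s"
  shows "moment \<beta> (proj i h) = 0"
proof -
  obtain \<alpha> where \<alpha>: "\<alpha> \<in> multi_indices s" "moment \<alpha> = moment \<beta>" using ex_multi_index[OF \<beta>] by metis
  let ?m = "\<lambda>\<gamma>. moment \<gamma> (\<lambda>u. cutoff i u * h u)"
  have "moment \<alpha> (\<lambda>x. 1 * (cutoff i x * h x) - (\<Sum>\<gamma>\<in>multi_indices s. ?m \<gamma> * corrector i \<gamma> x)) =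
      1 * ?m \<alpha> - (\<Sum>\<gamma>\<in>multi_indices s. ?m \<gamma> * moment \<alpha> (corrector i \<gamma>))"
    by (rule moment_diff_sum[OF test_fun_cutoff_mult[OF h] test_fun_corrector])
  also have "(\<Sum>\<gamma>\<in>multi_indices s. ?m \<gamma> * moment \<alpha> (corrector i \<gamma>)) =
      (\<Sum>\<gamma>\<in>multi_indices s. if \<gamma> = \<alpha> then ?m \<gamma> else 0)"
    by (rule sum.cong) (simp_all add: moment_corrector \<alpha>(1))
  also have "\<dots> = ?m \<alpha>" using \<alpha> by (simp add: finite_multi_indices sum.delta)
  finally have "moment \<alpha> (proj i h) = 0" by (simp add: proj_def[abs_def])
  then show ?thesis by (simp add: \<alpha>)
qed

text \<open>Once the cutoff is 1 on the support of \<open>h\<close>, the coefficients of the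
  correction are the moments of \<open>h\<close> itself, which vanish.\<close>

lemma proj_eq_self:
  assumes supp: "\<And>x. 2 ^ i < norm x \<Longrightarrow> h x = 0"
    and moments: "\<And>\<alpha>. mi_order \<alpha> \<le> s \<Longrightarrow> moment \<alpha> h = 0"
  shows "proj i h = h"
proof -
  have eq: "cutoff i x * h x = h x" for x
    by (cases "norm x \<le> 2 ^ i") (simp_all add: cutoff_eq_1 supp)
  show ?thesis
    unfolding proj_def[abs_def] eq by (simp add: moments multi_indices_def)
qed

lemma proj_eq_0: "R * 2 ^ i < norm x \<Longrightarrow> proj i h x = 0"
proof -
  assume x: "R * 2 ^ i < norm x"
  moreover have "2 * 2 ^ i \<le> R * 2 ^ i" using R_ge by simp
  ultimately have "2 * 2 ^ i \<le> norm x" by linarith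
  then show ?thesis using x by (simp add: proj_def cutoff_eq_0 corrector_eq_0)
qed

lemma block_eq_0: "R * 2 ^ i < norm x \<Longrightarrow> block i h x = 0"
proof -
  assume x: "R * 2 ^ i < norm x"
  have "R * 2 ^ (i - 1) \<le> R * 2 ^ i" using R_ge by (intro mult_left_mono power_increasing) auto
  then show ?thesis using x by (simp add: block_def proj_eq_0)
qed

text \<open>Moments in the first variable vanish by construction. Those in the second vanish for
  \<open>f\<close> and for each coefficient function, hence for the combination.\<close>

lemma proj_Dspace:
  assumes f: "f \<in> Dspace s s2"
  shows "(\<lambda>x y. proj i (\<lambda>u. f u y) x) \<in> Dspace s s2"
proof -
  have tf: "test_fun (\<lambda>z. f (fst z) (snd z))" using f by (simp add: Dspace_iff)
  have m_tf: "test_fun (\<lambda>y. moment \<alpha> (\<lambda>u. cutoff i u * f u y))" for \<alpha>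
    by (rule test_fun_moment_slice[OF tf smooth_cutoff, of "2 * 2 ^ i"]) (simp add: cutoff_eq_0)
  have "moment \<beta> (\<lambda>y. proj i (\<lambda>u. f u y) x) = 0" if "mi_order \<beta> \<le> s2" for \<beta> x
  proof -
    have "moment \<beta> (\<lambda>y. cutoff i x * f x y -
          (\<Sum>\<alpha>\<in>multi_indices s. corrector i \<alpha> x * moment \<alpha> (\<lambda>u. cutoff i u * f u y))) =
        cutoff i x * moment \<beta> (f x) -
          (\<Sum>\<alpha>\<in>multi_indices s. corrector i \<alpha> x * moment \<beta> (\<lambda>y. moment \<alpha> (\<lambda>u. cutoff i u * f u y)))"
      by (rule moment_diff_sum[OF test_fun_slice2[OF tf] m_tf])
    also have "\<dots> = 0"
      using f that by (simp add: Dspace_iff moment_moment_slice_eq_0[OF tf smooth_cutoff])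
    finally show ?thesis by (simp add: proj_def mult.commute)
  qed
  moreover have "smooth (\<lambda>z. proj i (\<lambda>u. f u (snd z)) (fst z))"
    unfolding smooth_def proj_def
  proof (intro allI Ck_diff Ck_mult Ck_sum)
    fix k \<alpha>
    show "Ck k (\<lambda>z. cutoff i (fst z))"
      using smooth_cutoff unfolding smooth_def by (intro Ck_compose_linear[OF bounded_linear_fst]) blast
    show "Ck k (\<lambda>z. f (fst z) (snd z))" using tf by (simp add: test_fun_def smooth_def)
    show "Ck k (\<lambda>z. moment \<alpha> (\<lambda>u. cutoff i u * f u (snd z)))"
      using m_tf[of \<alpha>] unfolding test_fun_def smooth_def
      by (intro Ck_compose_linear[OF bounded_linear_snd, of k "\<lambda>y. moment \<alpha> (\<lambda>u. cutoff i u * f u y)"]) blast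
    show "Ck k (\<lambda>z. corrector i \<alpha> (fst z))" if "\<alpha> \<in> multi_indices s"
      using test_fun_corrector[OF that, of i] unfolding test_fun_def smooth_def
      by (intro Ck_compose_linear[OF bounded_linear_fst]) blast
  qed
  moreover have "\<exists>r. \<forall>z. r < norm z \<longrightarrow> proj i (\<lambda>u. f u (snd z)) (fst z) = 0"
  proof -
    obtain r where r: "\<And>z. r < norm z \<Longrightarrow> f (fst z) (snd z) = 0" using tf unfolding test_fun_def by blast
    \<comment> \<open>Beyond this radius either the first component leaves the support common to all
      truncations at scale \<open>i\<close>, or the second leaves that of \<open>f\<close>, and then
      the whole slice is 0.\<close>
    have "proj i (\<lambda>u. f u (snd z)) (fst z) = 0" if z: "\<bar>r\<bar> + R * 2 ^ i < norm z" for z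
    proof (cases "R * 2 ^ i < norm (fst z)")
      case False
      have "norm z \<le> norm (fst z) + norm (snd z)" using norm_Pair_le[of "fst z" "snd z"] by simp
      then have "r < norm (snd z)" using False z by linarith
      then have "f u (snd z) = 0" for u using r[of "(u, snd z)"] norm_snd_le[of "snd z" u] by simp
      then show ?thesis by (simp add: proj_def moment_def)
    qed (simp add: proj_eq_0)
    then show ?thesis by blast
  qed
  ultimately show ?thesis
    using moment_proj[OF test_fun_slice1[OF tf]] by (simp add: Dspace_iff test_fun_def)
qed

lemma block_Dspace:
  assumes f: "f \<in> Dspace s s2"
  shows "(\<lambda>x y. block i (\<lambda>u. f u y) x) \<in> Dspace s s2"
proof (cases "i = 0")
  case True
  then show ?thesis using proj_Dspace[OF f, of 0] by (simp add: block_def)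
next
  case False
  then show ?thesis
    using Dspace_linear_comb[OF proj_Dspace[OF f, of i] proj_Dspace[OF f, of "i - 1"], of 1 "-1"]
    by (simp add: block_def)
qed

end

section \<open>Decay estimates for truncated moments and blocks\<close>

lemma decay_at_dyadic:
  assumes "(1 + norm x) powr \<sigma> * a \<le> K" "0 \<le> a" "0 \<le> \<sigma>" "2 ^ k \<le> norm x"
  shows "a \<le> K * 2 powr (- (real k * \<sigma>))"
proof -
  have "2 powr (real k * \<sigma>) = (2 ^ k) powr \<sigma>" by (simp add: powr_powr[symmetric] powr_realpow)
  also have "\<dots> \<le> (1 + norm x) powr \<sigma>" using assms by (intro powr_mono2) auto
  finally have "2 powr (real k * \<sigma>) * a \<le> K" using assms mult_right_mono order_trans by blast
  then show ?thesis by (simp add: powr_minus field_simps)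
qed

context dyadic_cutoff
begin

text \<open>The factors come from the two cutoffs, the volume of the ball, and the 4 in the radius
  \<open>4 * 2 ^ k\<close>, raised to the largest possible exponent.\<close>

definition incr_const :: real where
  "incr_const = 2 * unit_ball_vol DIM('a) * 4 ^ (s + DIM('a))"

lemma incr_const_nonneg: "0 \<le> incr_const"
  by (simp add: incr_const_def)

text \<open>The difference of consecutive cutoffs lives where
  \<open>2 ^ k < norm x < 4 * 2 ^ k\<close>. There \<open>h\<close> is at most
  \<open>K * 2 powr (- (real k * \<sigma>))\<close>, while the monomial and the volume contribute
  powers of the radius with exponents \<open>mi_order \<alpha>\<close> and
  \<open>DIM('a)\<close>.\<close>

lemma moment_cutoff_increment_le:
  fixes h :: "'a \<Rightarrow> complex"
  assumes h: "test_fun h" and K: "\<And>x. (1 + norm x) powr \<sigma> * cmod (h x) \<le> K" and "0 \<le> \<sigma>"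
    and \<alpha>: "mi_order \<alpha> \<le> s"
  shows "cmod (moment \<alpha> (\<lambda>u. cutoff (Suc k) u * h u) - moment \<alpha> (\<lambda>u. cutoff k u * h u))
    \<le> incr_const * K * 2 powr (real k * (real (mi_order \<alpha> + DIM('a)) - \<sigma>))"
proof -
  define r :: real where "r = 4 * 2 ^ k"
  define c where "c = 2 * (K * 2 powr (- (real k * \<sigma>))) * r ^ mi_order \<alpha>"
  let ?g = "\<lambda>x. (cutoff (Suc k) x * h x + (-1) * (cutoff k x * h x))"
  let ?I = "\<lambda>x. ?g x * complex_of_real (monom_ml \<alpha> x)"
  have "0 \<le> K" using K[of 0] by (rule order_trans[rotated]) simp
  then have "0 \<le> c" by (simp add: c_def r_def)
  have tf: "test_fun ?g"
    using test_fun_linear_comb[OF test_fun_cutoff_mult[OF h, of "Suc k"] test_fun_cutoff_mult[OF h, of k], of 1 "-1"]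
    by simp
  have "moment \<alpha> (\<lambda>u. cutoff (Suc k) u * h u) - moment \<alpha> (\<lambda>u. cutoff k u * h u) = moment \<alpha> ?g"
    using moment_linear_comb[where \<alpha> = \<alpha> and a = 1 and b = "-1",
        OF test_fun_cutoff_mult[OF h, of "Suc k"] test_fun_cutoff_mult[OF h, of k]]
    by simp
  also have "cmod \<dots> \<le> (LINT x|lborel. cmod (?I x))"
    unfolding moment_def by (rule integral_norm_bound)
  also have "\<dots> \<le> (LINT x|lborel. c * indicator (cball (0::'a) r) x)"
  proof (rule Bochner_Integration.integral_mono)
    show "integrable lborel (\<lambda>x. cmod (?I x))"
      by (intro integrable_norm test_fun_integrable_moment tf)
    show "integrable lborel (\<lambda>x::'a. c * indicator (cball 0 r) x)"
      using emeasure_bounded_finite[of "cball (0::'a) r"]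
      by (intro integrable_mult_right integrable_real_indicator) auto
    show "cmod (?I x) \<le> c * indicator (cball 0 r) x" for x
    \<comment> \<open>Off the annulus both cutoffs agree: they are 1 inside and 0 outside.\<close>
    proof (cases "norm x \<le> 2 ^ k \<or> r \<le> norm x")
      case True
      have "cutoff (Suc k) x = cutoff k x"
        using True
      proof
        assume x: "norm x \<le> 2 ^ k"
        have "norm x \<le> 2 ^ Suc k" using x by (rule order_trans) simp
        then show ?thesis using x by (simp only: cutoff_eq_1)
      next
        assume x: "r \<le> norm x"
        have "2 * 2 ^ k \<le> norm x" "2 * 2 ^ Suc k \<le> norm x" 
          using x zero_le_power[of "2::real" k] unfolding r_def power_Suc by linarith+
        then show ?thesis by (simp only: cutoff_eq_0)
      qed
      then show ?thesis using \<open>0 \<le> c\<close> by simp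
    next
      case False
      have "cmod (?g x) \<le> cmod (cutoff (Suc k) x) * cmod (h x) + cmod (cutoff k x) * cmod (h x)"
        by (rule order_trans[OF norm_triangle_ineq]) (simp add: norm_mult)
      also have "\<dots> \<le> 1 * cmod (h x) + 1 * cmod (h x)"
        by (intro add_mono mult_right_mono cutoff_le_1) auto
      also have "\<dots> \<le> 2 * (K * 2 powr (- (real k * \<sigma>)))"
        using decay_at_dyadic[OF K, of x k] \<open>0 \<le> \<sigma>\<close> False by simp
      finally have "cmod (?g x) \<le> 2 * (K * 2 powr (- (real k * \<sigma>)))" .
      moreover have "\<bar>monom_ml \<alpha> x\<bar> \<le> r ^ mi_order \<alpha>"
        using False by (intro order_trans[OF abs_monom_ml_le] power_mono) auto
      ultimately have "cmod (?g x) * \<bar>monom_ml \<alpha> x\<bar> \<le> c"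
        unfolding c_def using \<open>0 \<le> K\<close> by (intro mult_mono) auto
      then show ?thesis using False by (simp add: norm_mult)
    qed
  qed
  also have "\<dots> = c * (unit_ball_vol DIM('a) * r ^ DIM('a))"
    by (simp add: content_cball r_def)
  also have "\<dots> = 2 * unit_ball_vol DIM('a) * K * 2 powr (- (real k * \<sigma>)) * r ^ (mi_order \<alpha> + DIM('a))"
    by (simp add: c_def power_add)
  also have "r ^ (mi_order \<alpha> + DIM('a)) =
      4 ^ (mi_order \<alpha> + DIM('a)) * 2 powr (real k * real (mi_order \<alpha> + DIM('a)))"
    unfolding r_def power_mult_distrib
    using powr_realpow[of 2 "k * (mi_order \<alpha> + DIM('a))"] by (simp add: power_mult)
  also have "2 * unit_ball_vol DIM('a) * K * 2 powr (- (real k * \<sigma>)) *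
        (4 ^ (mi_order \<alpha> + DIM('a)) * 2 powr (real k * real (mi_order \<alpha> + DIM('a)))) =
      (2 * unit_ball_vol DIM('a) * 4 ^ (mi_order \<alpha> + DIM('a))) * K *
        2 powr (real k * (real (mi_order \<alpha> + DIM('a)) - \<sigma>))"
    by (simp add: right_diff_distrib powr_diff powr_minus divide_inverse mult_ac)
  also have "\<dots> \<le> incr_const * K * 2 powr (real k * (real (mi_order \<alpha> + DIM('a)) - \<sigma>))"
    unfolding incr_const_def using \<open>0 \<le> K\<close> \<alpha>
    by (intro mult_right_mono mult_left_mono power_increasing) auto
  finally show ?thesis .
qed

text \<open>
  Since the full moment of \<open>h\<close> vanishes, the truncated moment is minus the tail of its
  increments, which form a geometric series; hence the induction runs downwards.
\<close>

lemma moment_cutoff_le: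
  fixes h :: "'a \<Rightarrow> complex"
  assumes h: "test_fun h" and K: "\<And>x. (1 + norm x) powr \<sigma> * cmod (h x) \<le> K"
    and \<sigma>: "real s + real DIM('a) < \<sigma>" and \<alpha>: "mi_order \<alpha> \<le> s" and 0: "moment \<alpha> h = 0"
  shows "cmod (moment \<alpha> (\<lambda>u. cutoff i u * h u)) \<le>
    incr_const / (1 - 2 powr (real s + real DIM('a) - \<sigma>)) * K *
      2 powr (real i * (real (mi_order \<alpha> + DIM('a)) - \<sigma>))"
proof -
  define \<tau> where "\<tau> = real (mi_order \<alpha> + DIM('a)) - \<sigma>"
  define \<rho> where "\<rho> = 2 powr (real s + real DIM('a) - \<sigma>)"
  \<comment> \<open>This value solves \<open>D * \<rho> + incr_const = D\<close>, so the bound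
    reproduces itself in each downward step. The ratio \<rho> bounds \<open>2 powr \<tau>\<close>
    for all admissible orders at once.\<close>
  define D where "D = incr_const / (1 - \<rho>)"
  define m where "m k = cmod (moment \<alpha> (\<lambda>u. cutoff k u * h u))" for k
  have "\<rho> < 2 powr 0" unfolding \<rho>_def using \<sigma> by (intro powr_less_mono) auto
  then have \<rho>: "\<rho> < 1" by simp
  have "2 powr \<tau> \<le> \<rho>" unfolding \<rho>_def \<tau>_def using \<alpha> by (intro powr_mono) auto
  have "0 \<le> K" using K[of 0] by (rule order_trans[rotated]) simp
  have "0 \<le> D" using \<rho> by (simp add: D_def incr_const_nonneg)
  obtain r where r: "\<And>x. r < norm x \<Longrightarrow> h x = 0" using h unfolding test_fun_def by blast
  \<comment> \<open>From scale \<open>M\<close> on the cutoff does not alter \<open>h\<close>, so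
    the truncated moments are 0; the downward induction starts here.\<close>
  obtain M :: nat where M: "r < 2 ^ M" using real_arch_pow[of 2 r] by auto
  have large: "m k = 0" if "M \<le> k" for k
  proof -
    have "r < 2 ^ k" using M power_increasing[OF that, of "2::real"] by linarith
    then have eq: "cutoff k x * h x = h x" for x
      by (cases "norm x \<le> 2 ^ k") (simp_all add: cutoff_eq_1 r)
    show ?thesis unfolding m_def eq by (simp add: 0)
  qed
  have step: "m k \<le> D * K * 2 powr (real k * \<tau>)" if IH: "m (Suc k) \<le> D * K * 2 powr (real (Suc k) * \<tau>)" for k
  proof -
    have "m k \<le> m (Suc k) + cmod (moment \<alpha> (\<lambda>u. cutoff (Suc k) u * h u) - moment \<alpha> (\<lambda>u. cutoff k u * h u))"
      unfolding m_def using norm_triangle_ineq3 norm_minus_commute by (smt (verit))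
    also have "\<dots> \<le> D * K * 2 powr (real (Suc k) * \<tau>) + incr_const * K * 2 powr (real k * \<tau>)"
      using moment_cutoff_increment_le[OF h K _ \<alpha>, of k] \<sigma> IH unfolding \<tau>_def by (intro add_mono) auto
    also have "\<dots> = (D * 2 powr \<tau> + incr_const) * (K * 2 powr (real k * \<tau>))"
      by (simp add: algebra_simps powr_add)
    also have "\<dots> \<le> (D * \<rho> + incr_const) * (K * 2 powr (real k * \<tau>))"
      using \<open>2 powr \<tau> \<le> \<rho>\<close> \<open>0 \<le> D\<close> \<open>0 \<le> K\<close>
      by (intro mult_right_mono add_right_mono mult_left_mono) auto
    also have "D * \<rho> + incr_const = D" using \<rho> by (simp add: D_def field_simps)
    finally show ?thesis by (simp add: mult.assoc)
  qed
  have "m i \<le> D * K * 2 powr (real i * \<tau>)"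
  proof (cases "i \<le> M")
    case True
    then show ?thesis
    proof (induction rule: inc_induct)
      case base
      show ?case using \<open>0 \<le> D\<close> \<open>0 \<le> K\<close> by (simp add: large)
    qed (rule step)
  next
    case False
    then show ?thesis using \<open>0 \<le> D\<close> \<open>0 \<le> K\<close> by (simp add: large)
  qed
  then show ?thesis by (simp add: m_def D_def \<rho>_def \<tau>_def)
qed

text \<open>The difference of cutoffs is nonzero only where \<open>h\<close> has already decayed. In
  the corrections the growth of the truncated moment in \<open>mi_order \<alpha> + DIM('a)\<close>
  is cancelled by the size of the corrector, leaving the same decay for every \<alpha>.\<close>

lemma block_decay:
  assumes \<sigma>: "real s + real DIM('a) < \<sigma>"
  obtains C where "0 < C"
    "\<And>h K i x. test_fun h \<Longrightarrow> (\<And>\<alpha>. mi_order \<alpha> \<le> s \<Longrightarrow> moment \<alpha> h = 0) \<Longrightarrow>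
      (\<And>x. (1 + norm x) powr \<sigma> * cmod (h x) \<le> K) \<Longrightarrow>
      cmod (block i h x) \<le> C * K * 2 powr (- (real i * \<sigma>))"
proof
  define D where "D = incr_const / (1 - 2 powr (real s + real DIM('a) - \<sigma>))"
  define E where "E = real (card (multi_indices s :: ('a \<Rightarrow> nat) set)) * (D * B)"
  \<comment> \<open>The three terms account for the difference of cutoffs, the corrections at scale
    \<open>i\<close> and those at scale \<open>i - 1\<close>. The factor
    \<open>2 powr \<sigma>\<close> converts decay at scale \<open>i - 1\<close> into decay at scale
    \<open>i\<close>.\<close>
  define C where "C = 2 * 2 powr \<sigma> + E + E * 2 powr \<sigma>"
  have "2 powr (real s + real DIM('a) - \<sigma>) < 2 powr 0" using \<sigma> by (intro powr_less_mono) auto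
  then have "0 \<le> D" by (simp add: D_def incr_const_nonneg)
  then have "0 \<le> E" using B_nonneg by (simp add: E_def)
  then show "0 < C" by (simp add: C_def add_pos_nonneg)
  fix h :: "'a \<Rightarrow> complex" and K i x
  assume h: "test_fun h" "\<And>\<alpha>. mi_order \<alpha> \<le> s \<Longrightarrow> moment \<alpha> h = 0"
    and K: "\<And>x. (1 + norm x) powr \<sigma> * cmod (h x) \<le> K"
  have "0 \<le> K" using K[of 0] by (rule order_trans[rotated]) simp
  define S where "S j = (\<Sum>\<alpha>\<in>multi_indices s. moment \<alpha> (\<lambda>u. cutoff j u * h u) * corrector j \<alpha> x)" for j
  have S: "cmod (S j) \<le> E * K * 2 powr (- (real j * \<sigma>))" for j
  proof -
    have "cmod (S j) \<le> (\<Sum>\<alpha>\<in>(multi_indices s :: ('a \<Rightarrow> nat) set). D * B * K * 2 powr (- (real j * \<sigma>)))"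
      unfolding S_def
    proof (rule sum_norm_le)
      fix \<alpha> :: "'a \<Rightarrow> nat" assume \<alpha>: "\<alpha> \<in> multi_indices s"
      define n where "n = mi_order \<alpha> + DIM('a)"
      have ord: "mi_order \<alpha> \<le> s" using \<alpha> by (simp add: multi_indices_def)
      have "cmod (moment \<alpha> (\<lambda>u. cutoff j u * h u)) \<le> D * K * 2 powr (real j * (real n - \<sigma>))"
        unfolding D_def n_def by (rule moment_cutoff_le[OF h(1) K \<sigma> ord h(2)[OF ord]])
      moreover have "cmod (corrector j \<alpha> x) \<le> (1 / 2 ^ j) ^ n * B"
        unfolding n_def by (rule corrector_le[OF \<alpha>])
      ultimately have "cmod (moment \<alpha> (\<lambda>u. cutoff j u * h u) * corrector j \<alpha> x) \<le>
          (D * K * 2 powr (real j * (real n - \<sigma>))) * ((1 / 2 ^ j) ^ n * B)"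
        unfolding norm_mult using \<open>0 \<le> D\<close> \<open>0 \<le> K\<close> by (intro mult_mono) auto
      also have "(1 / 2 ^ j) ^ n = 2 powr (- (real j * real n))"
        using powr_realpow[of 2 "j * n"] by (simp add: powr_minus divide_simps power_mult)
      also have "(D * K * 2 powr (real j * (real n - \<sigma>))) * (2 powr (- (real j * real n)) * B) =
          D * B * K * (2 powr (real j * (real n - \<sigma>)) * 2 powr (- (real j * real n)))"
        by simp
      also have "2 powr (real j * (real n - \<sigma>)) * 2 powr (- (real j * real n)) = 2 powr (- (real j * \<sigma>))"
        by (simp add: powr_add[symmetric] algebra_simps)
      finally show "cmod (moment \<alpha> (\<lambda>u. cutoff j u * h u) * corrector j \<alpha> x) \<le>
          D * B * K * 2 powr (- (real j * \<sigma>))" .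
    qed
    then show ?thesis by (simp add: E_def mult_ac)
  qed
  have hK: "cmod (h x) \<le> K"
  proof -
    have "1 * cmod (h x) \<le> (1 + norm x) powr \<sigma> * cmod (h x)"
      using \<sigma> by (intro mult_right_mono ge_one_powr_ge_zero) auto
    then show ?thesis using K[of x] by simp
  qed
  show "cmod (block i h x) \<le> C * K * 2 powr (- (real i * \<sigma>))"
  proof (cases i)
    case 0
    have "1 \<le> 2 powr \<sigma>" using \<sigma> by (intro ge_one_powr_ge_zero) auto
    have "cmod (block i h x) \<le> cmod (cutoff 0 x * h x) + cmod (S 0)"
      using norm_triangle_ineq4 by (simp add: 0 block_def proj_def S_def)
    also have "\<dots> \<le> 1 * K + E * K"
      using S[of 0] unfolding norm_mult by (intro add_mono mult_mono cutoff_le_1 hK) auto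
    also have "\<dots> = (1 + E) * K" by (simp add: algebra_simps)
    also have "\<dots> \<le> C * K"
    proof (rule mult_right_mono)
      have "0 \<le> E * 2 powr \<sigma>" using \<open>0 \<le> E\<close> by simp
      then show "1 + E \<le> C" using \<open>1 \<le> 2 powr \<sigma>\<close> unfolding C_def by linarith
    qed fact
    finally show ?thesis by (simp add: 0)
  next
    case (Suc k)
    define p where "p = 2 powr (- (real i * \<sigma>))"
    have pk: "2 powr (- (real k * \<sigma>)) = 2 powr \<sigma> * p"
      by (simp add: p_def Suc powr_add[symmetric] algebra_simps)
    have d: "cmod ((cutoff i x - cutoff k x) * h x) \<le> 2 * (K * 2 powr (- (real k * \<sigma>)))"
    proof (cases "norm x \<le> 2 ^ k")
      case True
      moreover have "norm x \<le> 2 ^ Suc k" using True by (rule order_trans) simp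
      ultimately have "cutoff i x - cutoff k x = 0" by (simp only: Suc cutoff_eq_1 diff_self)
      then show ?thesis using \<open>0 \<le> K\<close> by simp
    next
      case False
      have "cmod (cutoff i x - cutoff k x) \<le> 2"
        using norm_triangle_ineq4[of "cutoff i x" "cutoff k x"] cutoff_le_1[of i x] cutoff_le_1[of k x]
        by linarith
      moreover have "cmod (h x) \<le> K * 2 powr (- (real k * \<sigma>))"
        using decay_at_dyadic[OF K, of x k] False \<sigma> by simp
      ultimately show ?thesis unfolding norm_mult by (intro mult_mono) auto
    qed
    have "block i h x = (cutoff i x - cutoff k x) * h x - S i + S k"
      by (simp add: Suc block_def proj_def S_def algebra_simps)
    then have "cmod (block i h x) \<le> cmod ((cutoff i x - cutoff k x) * h x) + cmod (S i) + cmod (S k)"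
      using norm_triangle_ineq norm_triangle_ineq4 by (smt (verit))
    also have "\<dots> \<le> 2 * (K * (2 powr \<sigma> * p)) + E * K * p + E * K * (2 powr \<sigma> * p)"
      using d S[of i] S[of k] unfolding pk p_def[symmetric] by linarith
    also have "\<dots> = C * K * p" by (simp add: C_def algebra_simps)
    finally show ?thesis by (simp add: p_def)
  qed
qed

end

subsection \<open>Decomposition of the operator bound\<close>

lemma test_fun_bounded:
  assumes "test_fun g"
  obtains b where "0 \<le> b" "\<And>x. cmod (g x) \<le> b"
proof -
  obtain r where r: "\<And>x. r < norm x \<Longrightarrow> g x = 0" using assms unfolding test_fun_def by blast
  have "compact (g ` cball 0 r)"
    by (intro compact_continuous_image continuous_on_subset[OF test_fun_continuous[OF assms]]) auto
  then obtain b where b: "\<And>x. norm x \<le> r \<Longrightarrow> cmod (g x) \<le> b"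
    using compact_imp_bounded[THEN bounded_iff[THEN iffD1]] by fastforce
  have "cmod (g x) \<le> \<bar>b\<bar>" for x
    using b[of x] r[of x] by (cases "norm x \<le> r") auto
  then show thesis using that[of "\<bar>b\<bar>"] by simp
qed

lemma ex_dyadic_cutoff:
  obtains \<theta> :: "'a::euclidean_space \<Rightarrow> complex" and \<phi> R B where "dyadic_cutoff \<theta> \<phi> s R B"
proof -
  let ?A = "multi_indices s :: ('a \<Rightarrow> nat) set"
  obtain \<theta> :: "'a \<Rightarrow> complex" where \<theta>: "smooth \<theta>" "\<And>x. norm x \<le> 1 \<Longrightarrow> \<theta> x = 1"
    "\<And>x. 2 \<le> norm x \<Longrightarrow> \<theta> x = 0" "\<And>x. cmod (\<theta> x) \<le> 1"
    by (rule ex_smooth_cutoff) blast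
  have "\<exists>\<phi>. test_fun \<phi> \<and> moment \<alpha> \<phi> = 1 \<and>
      (\<forall>\<beta>. (\<forall>j\<in>Basis. \<beta> j \<le> s) \<longrightarrow> (\<exists>b\<in>Basis. \<beta> b \<noteq> \<alpha> b) \<longrightarrow> moment \<beta> \<phi> = 0)"
    for \<alpha> :: "'a \<Rightarrow> nat"
    by (rule ex_test_fun_dual_monomial[of \<alpha> s]) metis
  then obtain \<phi> where \<phi>: "\<And>\<alpha>. test_fun (\<phi> \<alpha>)" "\<And>\<alpha>::'a \<Rightarrow> nat. moment \<alpha> (\<phi> \<alpha>) = 1"
    and \<phi>0: "\<And>\<alpha> \<beta>. \<forall>j\<in>Basis. \<beta> j \<le> s \<Longrightarrow> \<exists>b\<in>Basis. \<beta> b \<noteq> \<alpha> b \<Longrightarrow> moment \<beta> (\<phi> \<alpha>) = 0"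
    by metis
  obtain r where r: "\<And>\<alpha> x. r \<alpha> < norm x \<Longrightarrow> \<phi> \<alpha> x = 0"
    using \<phi>(1) unfolding test_fun_def by metis
  obtain b where b: "\<And>\<alpha> x. cmod (\<phi> \<alpha> x) \<le> b \<alpha>" "\<And>\<alpha>. 0 \<le> b \<alpha>"
  proof -
    have "\<forall>\<alpha>. \<exists>b\<ge>0. \<forall>x. cmod (\<phi> \<alpha> x) \<le> b" using test_fun_bounded[OF \<phi>(1)] by blast
    then show thesis using that by metis
  qed
  define R where "R = 2 + (\<Sum>\<alpha>\<in>?A. \<bar>r \<alpha>\<bar>)"
  define B where "B = (\<Sum>\<alpha>\<in>?A. b \<alpha>)"
  have R: "r \<alpha> \<le> R" if "\<alpha> \<in> ?A" for \<alpha>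
    using member_le_sum[OF that, of "\<lambda>\<alpha>. \<bar>r \<alpha>\<bar>"] finite_multi_indices[of s, where 'a = 'a]
    unfolding R_def by fastforce
  have B: "b \<alpha> \<le> B" if "\<alpha> \<in> ?A" for \<alpha>
    unfolding B_def using that b(2) finite_multi_indices by (intro member_le_sum) auto
  have "dyadic_cutoff \<theta> \<phi> s R B"
  proof
    show "\<phi> \<alpha> x = 0" if "\<alpha> \<in> ?A" "R < norm x" for \<alpha> x using r[of \<alpha> x] R[OF that(1)] that(2) by linarith
    show "cmod (\<phi> \<alpha> x) \<le> B" if "\<alpha> \<in> ?A" for \<alpha> x using b(1)[of \<alpha> x] B[OF that] by linarith
    show "moment \<beta> (\<phi> \<alpha>) = (if \<alpha> = \<beta> then 1 else 0)" if "\<alpha> \<in> ?A" "\<beta> \<in> ?A" for \<alpha> \<beta>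
    proof (cases "\<alpha> = \<beta>")
      case False
      \<comment> \<open>Distinct members of \<open>multi_indices\<close> are both 0 off
        \<open>Basis\<close>, so they must differ at a basis vector, as duality requires.\<close>
      then obtain c where "\<beta> c \<noteq> \<alpha> c" by force
      moreover from this that have "c \<in> Basis" by (force simp: multi_indices_def)
      ultimately have "\<exists>b\<in>Basis. \<beta> b \<noteq> \<alpha> b" by blast
      moreover have "\<forall>j\<in>Basis. \<beta> j \<le> s"
        using mi_order_component_le[of _ \<beta>] that(2) unfolding multi_indices_def by fastforce
      ultimately show ?thesis using \<phi>0[of \<beta> \<alpha>] False by simp
    qed (simp add: \<phi>)
    show "2 \<le> R" unfolding R_def by (simp add: sum_nonneg)
    show "0 \<le> B" unfolding B_def by (simp add: b sum_nonneg)
  qed (use \<theta> \<phi> in auto)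
  then show thesis by (rule that)
qed

text \<open>The one-variable construction applied to slices, with constants chosen before
  \<open>f\<close>. The number of terms depends on the support of \<open>f\<close> and is the same
  for all slices. Exchanging the two types gives the version for the second variable.\<close>

lemma ex_block_decomposition:
  fixes \<sigma> :: real
  assumes \<sigma>: "real DIM('a) + real s1 < \<sigma>"
  obtains \<Delta> :: "nat \<Rightarrow> ('a::euclidean_space \<Rightarrow> complex) \<Rightarrow> 'a \<Rightarrow> complex" and C R :: real
  where "0 < C" "0 < R"
    "\<And>s2 (f :: 'a \<Rightarrow> 'b::euclidean_space \<Rightarrow> complex) i. f \<in> Dspace s1 s2 \<Longrightarrow>
      (\<lambda>x y. \<Delta> i (\<lambda>u. f u y) x) \<in> Dspace s1 s2"
    "\<And>i h x. R * 2 ^ i < norm x \<Longrightarrow> \<Delta> i h x = 0"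
    "\<And>s2 (f :: 'a \<Rightarrow> 'b \<Rightarrow> complex). f \<in> Dspace s1 s2 \<Longrightarrow>
      \<exists>m. f = (\<lambda>x y. \<Sum>i\<le>m. \<Delta> i (\<lambda>u. f u y) x)"
    "\<And>s2 (f :: 'a \<Rightarrow> 'b \<Rightarrow> complex) K y i x. f \<in> Dspace s1 s2 \<Longrightarrow>
      (\<And>u. (1 + norm u) powr \<sigma> * cmod (f u y) \<le> K) \<Longrightarrow>
      cmod (\<Delta> i (\<lambda>u. f u y) x) \<le> C * K * 2 powr (- (real i * \<sigma>))"
proof -
  obtain \<theta> :: "'a \<Rightarrow> complex" and \<phi> R B where "dyadic_cutoff \<theta> \<phi> s1 R B"
    by (rule ex_dyadic_cutoff)
  then interpret dyadic_cutoff \<theta> \<phi> s1 R B .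
  have "real s1 + real DIM('a) < \<sigma>" using \<sigma> by simp
  then obtain C where C: "0 < C"
    "\<And>h K i x. test_fun h \<Longrightarrow> (\<And>\<alpha>. mi_order \<alpha> \<le> s1 \<Longrightarrow> moment \<alpha> h = 0) \<Longrightarrow>
      (\<And>x. (1 + norm x) powr \<sigma> * cmod (h x) \<le> K) \<Longrightarrow>
      cmod (block i h x) \<le> C * K * 2 powr (- (real i * \<sigma>))"
    by (rule block_decay) blast
  show thesis
  proof (rule that[of C R block])
    show "0 < C" "0 < R" using C(1) R_ge by auto
    show "(\<lambda>x y. block i (\<lambda>u. f u y) x) \<in> Dspace s1 s2" if "f \<in> Dspace s1 s2"
      for s2 i and f :: "'a \<Rightarrow> 'b \<Rightarrow> complex" using that by (rule block_Dspace)
    show "R * 2 ^ i < norm x \<Longrightarrow> block i h x = 0" for i h x by (rule block_eq_0)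
    show "\<exists>m. f = (\<lambda>x y. \<Sum>i\<le>m. block i (\<lambda>u. f u y) x)" if f: "f \<in> Dspace s1 s2"
      for s2 and f :: "'a \<Rightarrow> 'b \<Rightarrow> complex"
    proof -
      have "test_fun (\<lambda>z. f (fst z) (snd z))" using f by (simp add: Dspace_iff)
      then obtain r where r: "\<And>z. r < norm z \<Longrightarrow> f (fst z) (snd z) = 0"
        unfolding test_fun_def by blast
      obtain m :: nat where m: "r < 2 ^ m" using real_arch_pow[of 2 r] by auto
      have "proj m (\<lambda>u. f u y) = (\<lambda>u. f u y)" for y
      proof (rule proj_eq_self)
        show "f x y = 0" if "2 ^ m < norm x" for x
          using r[of "(x, y)"] that m norm_fst_le[of x y] by simp
        show "moment \<alpha> (\<lambda>u. f u y) = 0" if "mi_order \<alpha> \<le> s1" for \<alpha>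
          using f that by (simp add: Dspace_iff)
      qed
      then have "f x y = (\<Sum>i\<le>m. block i (\<lambda>u. f u y) x)" for x y
        unfolding sum_block by (metis)
      then show ?thesis by blast
    qed
    show "cmod (block i (\<lambda>u. f u y) x) \<le> C * K * 2 powr (- (real i * \<sigma>))"
      if f: "f \<in> Dspace s1 s2" and K: "\<And>u. (1 + norm u) powr \<sigma> * cmod (f u y) \<le> K"
      for s2 K y i x and f :: "'a \<Rightarrow> 'b \<Rightarrow> complex"
      using f K by (intro C(2)) (simp_all add: Dspace_iff test_fun_slice1)
  qed
qed

section \<open>Weighted norms, diameters, and sublinearity over finite sums\<close>

lemma weighted_le_Dnorm:
  assumes f: "f \<in> Dspace s1 s2" and \<sigma>: "0 \<le> \<sigma>1" "0 \<le> \<sigma>2"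
  shows "(1 + norm x) powr \<sigma>1 * (1 + norm y) powr \<sigma>2 * cmod (f x y) \<le> Dnorm \<sigma>1 \<sigma>2 f"
proof -
  let ?w = "\<lambda>z. (1 + norm (fst z)) powr \<sigma>1 * (1 + norm (snd z)) powr \<sigma>2 * cmod (f (fst z) (snd z))"
  have tf: "test_fun (\<lambda>z. f (fst z) (snd z))" using f by (simp add: Dspace_iff)
  obtain r where r: "\<And>z. r < norm z \<Longrightarrow> f (fst z) (snd z) = 0" using tf unfolding test_fun_def by blast
  obtain b where b: "0 \<le> b" "\<And>z. cmod (f (fst z) (snd z)) \<le> b" using test_fun_bounded[OF tf] by blast
  have "?w z \<le> (1 + \<bar>r\<bar>) powr \<sigma>1 * (1 + \<bar>r\<bar>) powr \<sigma>2 * b" for z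
  proof (cases "r < norm z")
    case True
    then show ?thesis using r b(1) by simp
  next
    case False
    have "norm (fst z) \<le> \<bar>r\<bar>" "norm (snd z) \<le> \<bar>r\<bar>"
      using False norm_fst_le[of "fst z" "snd z"] norm_snd_le[of "snd z" "fst z"] by auto
    then show ?thesis using \<sigma> b by (intro mult_mono powr_mono2) auto
  qed
  \<comment> \<open>A real supremum dominates its members only if the set is bounded above; the
    compact support of \<open>f\<close> ensures this.\<close>
  then have "bdd_above (range ?w)" by (auto intro!: bdd_aboveI2)
  then show ?thesis unfolding Dnorm_def using cSUP_upper[of "(x, y)" UNIV ?w] by simp
qed

lemma diam1_bounds:
  assumes "\<And>x y. f x y \<noteq> 0 \<Longrightarrow> norm x \<le> r" "0 \<le> r"
  shows "0 \<le> diam1 f" "diam1 f \<le> 2 * r"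
proof -
  let ?S = "{dist x1 y1 | x1 y1 x2. f x1 x2 \<noteq> 0 \<and> f y1 x2 \<noteq> 0} \<union> {0}"
  have le: "d \<le> 2 * r" if "d \<in> ?S" for d
    using that
  proof
    assume "d \<in> {dist x1 y1 | x1 y1 x2. f x1 x2 \<noteq> 0 \<and> f y1 x2 \<noteq> 0}"
    then obtain x1 y1 x2 where "d = dist x1 y1" "f x1 x2 \<noteq> 0" "f y1 x2 \<noteq> 0" by blast
    then show ?thesis
      using assms(1)[of x1 x2] assms(1)[of y1 x2] norm_triangle_ineq4[of x1 y1]
      by (simp add: dist_norm)
  qed (use assms(2) in simp)
  then have "bdd_above ?S" by (rule bdd_aboveI)
  \<comment> \<open>The adjoined 0 keeps the set nonempty even when \<open>f\<close> is 0, and gives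
    the sign.\<close>
  then show "0 \<le> diam1 f" unfolding diam1_def by (intro cSup_upper) auto
  show "diam1 f \<le> 2 * r" unfolding diam1_def by (rule cSup_least) (use le in auto)
qed

lemma diam2_eq_diam1: "diam2 f = diam1 (\<lambda>y x. f x y)"
  by (simp add: diam1_def diam2_def)

lemma sup_norm_bounds:
  assumes "\<And>x y. cmod (f x y) \<le> M"
  shows "0 \<le> sup_norm f" "sup_norm f \<le> M"
proof -
  have "bdd_above (range (\<lambda>z. cmod (f (fst z) (snd z))))" using assms by (auto intro!: bdd_aboveI2)
  then have "cmod (f undefined undefined) \<le> sup_norm f"
    unfolding sup_norm_def using cSUP_upper[of "(undefined, undefined)" UNIV] by fastforce
  then show "0 \<le> sup_norm f" using norm_ge_zero order_trans by blast
  show "sup_norm f \<le> M" unfolding sup_norm_def by (rule cSUP_least) (auto simp: assms)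
qed

text \<open>Raised to the power \<open>q\<close>, sublinearity becomes plain subadditivity and
  iterates without any growth of constants. Membership in \<open>Dspace\<close> is carried along
  because sublinearity speaks only of functions in that space.\<close>

lemma sublinear_sum_le:
  assumes T: "Bq_sublinear q N T (Dspace s1 s2)" and q: "0 < q" and N: "\<And>v. 0 \<le> N v"
    and F: "\<And>i. F i \<in> Dspace s1 s2"
  shows "(\<lambda>x y. \<Sum>i\<le>m. F i x y) \<in> Dspace s1 s2 \<and>
    N (T (\<lambda>x y. \<Sum>i\<le>m::nat. F i x y)) powr q \<le> (\<Sum>i\<le>m. N (T (F i)) powr q)"
proof (induction m)
  case 0
  then show ?case using F[of 0] by simp
next
  case (Suc m)
  let ?S = "\<lambda>x y. \<Sum>i\<le>m. F i x y"
  have "N (T (\<lambda>x y. 1 * ?S x y + 1 * F (Suc m) x y)) \<le>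
      (cmod 1 powr q * N (T ?S) powr q + cmod 1 powr q * N (T (F (Suc m))) powr q) powr (1 / q)"
    using T[unfolded Bq_sublinear_def, rule_format, OF conjunct1[OF Suc] F[of "Suc m"], of 1 1]
    by (rule conjunct1)
  then have "N (T (\<lambda>x y. \<Sum>i\<le>Suc m. F i x y)) \<le> (N (T ?S) powr q + N (T (F (Suc m))) powr q) powr (1 / q)"
    by simp
  then have "N (T (\<lambda>x y. \<Sum>i\<le>Suc m. F i x y)) powr q \<le>
      ((N (T ?S) powr q + N (T (F (Suc m))) powr q) powr (1 / q)) powr q"
    using N q by (intro powr_mono2) auto
  also have "\<dots> = N (T ?S) powr q + N (T (F (Suc m))) powr q"
    using q by (simp add: powr_powr)
  also have "\<dots> \<le> (\<Sum>i\<le>Suc m. N (T (F i)) powr q)" using Suc by simp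
  finally show ?case
    using Dspace_linear_comb[of ?S s1 s2 "F (Suc m)" 1 1] Suc F by simp
qed

text \<open>The bound is uniform in \<open>m\<close>, as it must be, since the number of blocks
  depends on the function decomposed.\<close>

lemma sum_power_le:
  fixes x :: real
  assumes "0 \<le> x" "x < 1"
  shows "(\<Sum>i\<le>m. x ^ i) \<le> 1 / (1 - x)"
proof -
  have "(1 - x) * (\<Sum>i\<le>m. x ^ i) \<le> 1"
    unfolding sum_gp_basic using assms by simp
  then show ?thesis using assms by (simp add: pos_le_divide_eq mult.commute)
qed

theorem lemma2p4:
  fixes p q :: real and sc :: "complex \<Rightarrow> 'v::ab_group_add \<Rightarrow> 'v" and N :: "'v \<Rightarrow> real"
    and s1 s2 :: nat and \<sigma>1 \<sigma>2 :: real
    and T :: "('a::euclidean_space \<Rightarrow> 'b::euclidean_space \<Rightarrow> complex) \<Rightarrow> 'v"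
  assumes "0 < p" "p \<le> 1" "p \<le> q" "q \<le> 1"
    and "q_quasi_banach q sc N"
    and "max (real DIM('a) / p) (real DIM('a) + real s1) < \<sigma>1" "\<sigma>1 < real DIM('a) + real s1 + 1"
    and "max (real DIM('b) / p) (real DIM('b) + real s2) < \<sigma>2" "\<sigma>2 < real DIM('b) + real s2 + 1"
    and "Bq_sublinear q N T (Dspace s1 s2)"
    and "\<exists>C>0. \<forall>f\<in>Dspace s1 s2.
           N (T f) \<le> C * diam1 f powr (real DIM('a) / p) * diam2 f powr (real DIM('b) / p) * sup_norm f"
  shows "\<exists>C'>0. \<forall>f\<in>Dspace s1 s2. N (T f) \<le> C' * Dnorm \<sigma>1 \<sigma>2 f"
proof -
  define e1 e2 where "e1 = real DIM('a) / p" and "e2 = real DIM('b) / p"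
  have q: "0 < q" and N: "\<And>v. 0 \<le> N v" using assms(5) by (auto simp: q_quasi_banach_def)
  have e: "0 \<le> e1" "0 \<le> e2" "e1 < \<sigma>1" "e2 < \<sigma>2" using assms by (auto simp: e1_def e2_def)
  obtain C0 where "0 < C0" and C0: "\<And>f. f \<in> Dspace s1 s2 \<Longrightarrow>
      N (T f) \<le> C0 * diam1 f powr e1 * diam2 f powr e2 * sup_norm f"
    using assms(11) unfolding e1_def e2_def by blast
  have "real DIM('a) + real s1 < \<sigma>1" using assms(6) by simp
  then obtain \<Delta>1 :: "nat \<Rightarrow> ('a \<Rightarrow> complex) \<Rightarrow> 'a \<Rightarrow> complex" and C1 R1 :: real
    where "0 < C1" "0 < R1"
    and D1: "\<And>s2 (f :: 'a \<Rightarrow> 'b \<Rightarrow> complex) i. f \<in> Dspace s1 s2 \<Longrightarrow>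
      (\<lambda>x y. \<Delta>1 i (\<lambda>u. f u y) x) \<in> Dspace s1 s2"
    and supp1: "\<And>i h x. R1 * 2 ^ i < norm x \<Longrightarrow> \<Delta>1 i h x = 0"
    and sum1: "\<And>s2 (f :: 'a \<Rightarrow> 'b \<Rightarrow> complex). f \<in> Dspace s1 s2 \<Longrightarrow>
      \<exists>m. f = (\<lambda>x y. \<Sum>i\<le>m. \<Delta>1 i (\<lambda>u. f u y) x)"
    and decay1: "\<And>s2 (f :: 'a \<Rightarrow> 'b \<Rightarrow> complex) K y i x. f \<in> Dspace s1 s2 \<Longrightarrow>
      (\<And>u. (1 + norm u) powr \<sigma>1 * cmod (f u y) \<le> K) \<Longrightarrow>
      cmod (\<Delta>1 i (\<lambda>u. f u y) x) \<le> C1 * K * 2 powr (- (real i * \<sigma>1))"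
    by (rule ex_block_decomposition[where ?'a = 'a and ?'b = 'b]) blast
  \<comment> \<open>The second variable is treated as the first variable of the swapped
    function.\<close>
  have "real DIM('b) + real s2 < \<sigma>2" using assms(8) by simp
  then obtain \<Delta>2 :: "nat \<Rightarrow> ('b \<Rightarrow> complex) \<Rightarrow> 'b \<Rightarrow> complex" and C2 R2 :: real
    where "0 < C2" "0 < R2"
    and D2: "\<And>s1 (f :: 'b \<Rightarrow> 'a \<Rightarrow> complex) i. f \<in> Dspace s2 s1 \<Longrightarrow>
      (\<lambda>x y. \<Delta>2 i (\<lambda>u. f u y) x) \<in> Dspace s2 s1"
    and supp2: "\<And>i h x. R2 * 2 ^ i < norm x \<Longrightarrow> \<Delta>2 i h x = 0"
    and sum2: "\<And>s1 (f :: 'b \<Rightarrow> 'a \<Rightarrow> complex). f \<in> Dspace s2 s1 \<Longrightarrow>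
      \<exists>m. f = (\<lambda>x y. \<Sum>i\<le>m. \<Delta>2 i (\<lambda>u. f u y) x)"
    and decay2: "\<And>s1 (f :: 'b \<Rightarrow> 'a \<Rightarrow> complex) K y i x. f \<in> Dspace s2 s1 \<Longrightarrow>
      (\<And>u. (1 + norm u) powr \<sigma>2 * cmod (f u y) \<le> K) \<Longrightarrow>
      cmod (\<Delta>2 i (\<lambda>u. f u y) x) \<le> C2 * K * 2 powr (- (real i * \<sigma>2))"
    by (rule ex_block_decomposition[where ?'a = 'b and ?'b = 'a]) blast
  \<comment> \<open>The constant for a single piece: \<open>2 * R1\<close> and \<open>2 * R2\<close>
    come from the diameters of its support, \<open>C1 * C2\<close> from the two decay
    estimates.\<close>
  define A where "A = C0 * (2 * R1) powr e1 * (2 * R2) powr e2 * (C1 * C2)"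
  \<comment> \<open>Ratios of the two geometric series after raising to the power \<open>q\<close>;
    they are below 1 because \<sigma>1 and \<sigma>2 exceed \<open>e1\<close> and \<open>e2\<close>.
    Their limits multiply to \<open>W\<close>.\<close>
  define a b where "a = 2 powr ((e1 - \<sigma>1) * q)" and "b = 2 powr ((e2 - \<sigma>2) * q)"
  define W where "W = 1 / (1 - a) * (1 / (1 - b))"
  have "2 powr ((e1 - \<sigma>1) * q) < 2 powr 0" "2 powr ((e2 - \<sigma>2) * q) < 2 powr 0"
    using e q by (intro powr_less_mono; simp add: mult_neg_pos)+
  then have ab: "0 \<le> a" "a < 1" "0 \<le> b" "b < 1" by (simp_all add: a_def b_def)
  have "0 < A"
    unfolding A_def using \<open>0 < C0\<close> \<open>0 < C1\<close> \<open>0 < C2\<close> \<open>0 < R1\<close> \<open>0 < R2\<close> by simp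
  have "0 < W" unfolding W_def using ab by simp
  have "N (T f) \<le> A * W powr (1 / q) * Dnorm \<sigma>1 \<sigma>2 f" if f: "f \<in> Dspace s1 s2" for f
  proof -
    define D where "D = Dnorm \<sigma>1 \<sigma>2 f"
    have w: "(1 + norm x) powr \<sigma>1 * (1 + norm y) powr \<sigma>2 * cmod (f x y) \<le> D" for x y
      unfolding D_def using weighted_le_Dnorm[OF f] e by simp
    have "0 \<le> D" using w[of 0 0] by (rule order_trans[rotated]) simp
    \<comment> \<open>First a block in \<open>y\<close> with \<open>x\<close> as a parameter, then a
      block in \<open>x\<close> of the result.\<close>
    define g where "g j x y = \<Delta>2 j (f x) y" for j x y
    define k where "k j i x y = \<Delta>1 i (\<lambda>u. g j u y) x" for j i x y
    have g: "g j \<in> Dspace s1 s2" for j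
      unfolding g_def[abs_def] using Dspace_swap[OF D2[OF Dspace_swap[OF f], of j]] by simp
    have k: "k j i \<in> Dspace s1 s2" for i j
      unfolding k_def[abs_def] using D1[OF g] .
    \<comment> \<open>For fixed \<open>x\<close> the slice \<open>f x\<close> decays in
      \<open>y\<close> with constant \<open>D / (1 + norm x) powr \<sigma>1\<close>. The block in
      \<open>y\<close> thus retains the weight in \<open>x\<close>, which is the decay that the
      second decomposition consumes.\<close>
    have g_decay: "(1 + norm x) powr \<sigma>1 * cmod (g j x y) \<le> C2 * D * 2 powr (- (real j * \<sigma>2))" for j x y
    proof -
      have pos: "0 < (1 + norm x) powr \<sigma>1" by (simp add: add_pos_nonneg[THEN less_imp_neq, symmetric])
      have "(1 + norm v) powr \<sigma>2 * cmod (f x v) \<le> D / (1 + norm x) powr \<sigma>1" for v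
        using w[of x v] pos by (simp add: pos_le_divide_eq mult_ac)
      then have "cmod (g j x y) \<le> C2 * (D / (1 + norm x) powr \<sigma>1) * 2 powr (- (real j * \<sigma>2))"
        unfolding g_def using decay2[OF Dspace_swap[OF f], of x "D / (1 + norm x) powr \<sigma>1" j y] by simp
      then show ?thesis using pos by (simp add: field_simps)
    qed
    have k_le: "cmod (k j i x y) \<le> C1 * (C2 * D * 2 powr (- (real j * \<sigma>2))) * 2 powr (- (real i * \<sigma>1))"
      for i j x y
      unfolding k_def by (rule decay1[OF g g_decay])
    have k_supp1: "norm x \<le> R1 * 2 ^ i" if "k j i x y \<noteq> 0" for i j x y
      using that supp1[of i x] unfolding k_def by (meson not_le)
    have k_supp2: "norm y \<le> R2 * 2 ^ j" if "k j i x y \<noteq> 0" for i j x y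
    proof (rule ccontr)
      assume "\<not> norm y \<le> R2 * 2 ^ j"
      then have "g j u y = 0" for u unfolding g_def by (intro supp2) simp
      \<comment> \<open>The slice of \<open>g j\<close> at this \<open>y\<close> is identically 0,
        so the decay estimate with \<open>K = 0\<close> forces its block to vanish.\<close>
      then have "cmod (k j i x y) \<le> C1 * 0 * 2 powr (- (real i * \<sigma>1))"
        unfolding k_def by (intro decay1[OF g]) simp
      then show False using that by simp
    qed
    have k_T: "N (T (k j i)) powr q \<le> (A * D) powr q * a ^ i * b ^ j" for i j
    proof -
      let ?M = "C1 * (C2 * D * 2 powr (- (real j * \<sigma>2))) * 2 powr (- (real i * \<sigma>1))"
      have d1: "0 \<le> diam1 (k j i)" "diam1 (k j i) \<le> 2 * (R1 * 2 ^ i)"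
        using diam1_bounds[of "k j i" "R1 * 2 ^ i"] k_supp1 \<open>0 < R1\<close> by auto
      have d2: "0 \<le> diam2 (k j i)" "diam2 (k j i) \<le> 2 * (R2 * 2 ^ j)"
        unfolding diam2_eq_diam1
        using diam1_bounds[of "\<lambda>y x. k j i x y" "R2 * 2 ^ j"] k_supp2 \<open>0 < R2\<close> by auto
      have "N (T (k j i)) \<le> C0 * diam1 (k j i) powr e1 * diam2 (k j i) powr e2 * sup_norm (k j i)"
        by (rule C0[OF k])
      \<comment> \<open>The hypothesis on \<open>T\<close> loses \<open>e1\<close> and
        \<open>e2\<close> powers of the scales through the diameters, while \<open>?M\<close> gains
        \<sigma>1 and \<sigma>2 powers; the net exponents are negative.\<close>
      also have "\<dots> \<le> C0 * (2 * (R1 * 2 ^ i)) powr e1 * (2 * (R2 * 2 ^ j)) powr e2 * ?M"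
        using d1 d2 e \<open>0 < C0\<close> sup_norm_bounds[OF k_le]
        by (intro mult_mono powr_mono2) auto
      also have "\<dots> = A * D * ((2 ^ i) powr e1 * 2 powr (- (real i * \<sigma>1))) * ((2 ^ j) powr e2 * 2 powr (- (real j * \<sigma>2)))"
        using \<open>0 < R1\<close> \<open>0 < R2\<close> by (simp add: A_def powr_mult mult_ac)
      also have "(2 ^ i) powr e1 * 2 powr (- (real i * \<sigma>1)) = (2 powr (e1 - \<sigma>1)) ^ i"
        by (simp add: powr_realpow[symmetric] powr_powr powr_add[symmetric] algebra_simps)
      also have "(2 ^ j) powr e2 * 2 powr (- (real j * \<sigma>2)) = (2 powr (e2 - \<sigma>2)) ^ j"
        by (simp add: powr_realpow[symmetric] powr_powr powr_add[symmetric] algebra_simps)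
      finally have "N (T (k j i)) powr q \<le> (A * D * (2 powr (e1 - \<sigma>1)) ^ i * (2 powr (e2 - \<sigma>2)) ^ j) powr q"
        using N q by (intro powr_mono2) auto
      also have "\<dots> = (A * D) powr q * ((2 powr (e1 - \<sigma>1)) ^ i) powr q * ((2 powr (e2 - \<sigma>2)) ^ j) powr q"
        using \<open>0 < A\<close> \<open>0 \<le> D\<close> by (simp add: powr_mult)
      also have "((2 powr (e1 - \<sigma>1)) ^ i) powr q = a ^ i"
        by (simp add: a_def powr_realpow[symmetric] powr_powr mult_ac)
      also have "((2 powr (e2 - \<sigma>2)) ^ j) powr q = b ^ j"
        by (simp add: b_def powr_realpow[symmetric] powr_powr mult_ac)
      finally show ?thesis .
    qed
    have g_T: "N (T (g j)) powr q \<le> (A * D) powr q * (1 / (1 - a)) * b ^ j" for j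
    proof -
      obtain m where m: "g j = (\<lambda>x y. \<Sum>i\<le>m. k j i x y)" using sum1[OF g] unfolding k_def by blast
      have "N (T (g j)) powr q \<le> (\<Sum>i\<le>m. N (T (k j i)) powr q)"
        unfolding m using sublinear_sum_le[where F = "k j", OF assms(10) q N k] by blast
      also have "\<dots> \<le> (\<Sum>i\<le>m. (A * D) powr q * a ^ i * b ^ j)" by (intro sum_mono k_T)
      also have "\<dots> = (A * D) powr q * (\<Sum>i\<le>m. a ^ i) * b ^ j"
        by (simp add: sum_distrib_left sum_distrib_right)
      also have "\<dots> \<le> (A * D) powr q * (1 / (1 - a)) * b ^ j"
        using ab by (intro mult_right_mono mult_left_mono sum_power_le) auto
      finally show ?thesis .
    qed
    have f_T: "N (T f) powr q \<le> (A * D) powr q * W"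
    proof -
      obtain m where "(\<lambda>y x. f x y) = (\<lambda>y x. \<Sum>j\<le>m. g j x y)"
        using sum2[OF Dspace_swap[OF f]] unfolding g_def by blast
      then have m: "f = (\<lambda>x y. \<Sum>j\<le>m. g j x y)" by (metis (no_types))
      have "N (T f) powr q \<le> (\<Sum>j\<le>m. N (T (g j)) powr q)"
        unfolding m using sublinear_sum_le[where F = g, OF assms(10) q N g] by blast
      also have "\<dots> \<le> (\<Sum>j\<le>m. (A * D) powr q * (1 / (1 - a)) * b ^ j)" by (intro sum_mono g_T)
      also have "\<dots> = (A * D) powr q * (1 / (1 - a)) * (\<Sum>j\<le>m. b ^ j)"
        by (simp add: sum_distrib_left)
      also have "\<dots> \<le> (A * D) powr q * (1 / (1 - a)) * (1 / (1 - b))"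
        using ab by (intro mult_left_mono sum_power_le) auto
      finally show ?thesis by (simp add: W_def)
    qed
    \<comment> \<open>Taking the \<open>q\<close>-th root restores linear dependence on
      \<open>D\<close> and turns the sum of the series into the factor
      \<open>W powr (1 / q)\<close>.\<close>
    have "N (T f) = (N (T f) powr q) powr (1 / q)" using N q by (simp add: powr_powr)
    also have "\<dots> \<le> ((A * D) powr q * W) powr (1 / q)"
      using f_T q by (intro powr_mono2) auto
    also have "\<dots> = A * D * W powr (1 / q)"
      using \<open>0 < A\<close> \<open>0 \<le> D\<close> \<open>0 < W\<close> q by (simp add: powr_mult powr_powr)
    finally show ?thesis by (simp add: D_def mult_ac)
  qed
  then show ?thesis
    using \<open>0 < A\<close> \<open>0 < W\<close> by (intro exI[of _ "A * W powr (1 / q)"]) simp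
qed

end
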